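(* There exist a universal constant $C_0>0$ and constants $D_1(q)>0$ ($q\ge2$), depending only on $q$, with $D_1(q)=O(\sqrt q\,\log q)$, such that the following holds. Let $q\ge2$, $d\ge1$, $N\ge1$ be integers, let $0<\varepsilon,\delta<1$, and let $$M\ge C_0\,d\,D_1(q)^{2d^2}\,\varepsilon^{-(d+1)}\log\!\left(\frac{|\Lambda_{\le d,q,N}|}{\delta}\right)$$ be an integer. Then there exists a randomized algorithm which, for every $f\in\mathcal B_{\le d}(C_q^N)$ with $\|f\|_{L_\infty(C_q^N)}\le 1$, from $M$ independent uniformly distributed samples $(X_1,f(X_1)),\ldots,(X_M,f(X_M))$, $X_j\sim\mathrm{Unif}(C_q^N)$, constructs a random hypothesis $h:C_q^N\to\mathbb C$ such that $$\|h-f\|_{L^2(C_q^N)}^2<\varepsilon$$ with probability at least $1-\delta$.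
   Context: $C_q\subset\mathbb C$ is the group of $q$-th roots of unity. For $\bm m\in\{0,\ldots,q-1\}^N$, $\chi_{\bm m}(x)=x_1^{m_1}\cdots x_N^{m_N}$ ($x\in C_q^N$) and $\operatorname{supp}(\bm m)=\{j:m_j\neq0\}$. $\Lambda_{\le d,q,N}=\{\bm m\in\{0,\ldots,q-1\}^N:|\operatorname{supp}(\bm m)|\le d\}$, so $|\Lambda_{\le d,q,N}|=\sum_{k=0}^d(q-1)^k\binom Nk$. $\mathcal B_{\le d}(C_q^N)=\operatorname{span}_{\mathbb C}\{\chi_{\bm m}:\bm m\in\Lambda_{\le d,q,N}\}$. $\|g\|_{L_\infty(C_q^N)}=\max_{x\in C_q^N}|g(x)|$ and $\|g\|_{L^2(C_q^N)}^2=q^{-N}\sum_{x\in C_q^N}|g(x)|^2$. An algorithm here is a rule assigning to the sample data $(X_j,f(X_j))_{j=1}^M$ a function $h$ on $C_q^N$; the rule may depend on $q,d,N,M,\varepsilon,\delta$ but has no access to $f$ other than through the samples. $D_1(q)=O(\sqrt q\log q)$ means $D_1(q)\le A\sqrt q\log q$ for all $q\ge2$ with an absolute constant $A$. *)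

theory Defs
  imports "HOL-Probability.Probability"
begin

text \<open>Coordinates are indexed by \<open>{..<N}\<close>; points of \<open>C_q^N\<close> and multi-indices are extensional
  functions on \<open>{..<N}\<close>, so that \<open>C_q^N\<close> has exactly \<open>q ^ N\<close> elements.\<close>

definition roots_of_unity :: "nat \<Rightarrow> complex set" where
  "roots_of_unity q = {z. z ^ q = 1}"

definition cyclic_cube :: "nat \<Rightarrow> nat \<Rightarrow> (nat \<Rightarrow> complex) set" where
  "cyclic_cube q N = {..<N} \<rightarrow>\<^sub>E roots_of_unity q"

definition multi_indices :: "nat \<Rightarrow> nat \<Rightarrow> nat \<Rightarrow> (nat \<Rightarrow> nat) set" where
  "multi_indices d q N =
     {m \<in> {..<N} \<rightarrow>\<^sub>E {0..<q}. card {j \<in> {..<N}. m j \<noteq> 0} \<le> d}"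

definition character :: "nat \<Rightarrow> (nat \<Rightarrow> nat) \<Rightarrow> (nat \<Rightarrow> complex) \<Rightarrow> complex" where
  "character N m x = (\<Prod>j<N. x j ^ m j)"

text \<open>A function on \<open>C_q^N\<close> is represented by a total function of which only the values on
  \<open>cyclic_cube q N\<close> matter; membership in the complex span of the (finitely many) characters
  is therefore only required to hold there.\<close>

definition low_degree_functions :: "nat \<Rightarrow> nat \<Rightarrow> nat \<Rightarrow> ((nat \<Rightarrow> complex) \<Rightarrow> complex) set" where
  "low_degree_functions d q N =
     {f. \<exists>c :: (nat \<Rightarrow> nat) \<Rightarrow> complex. \<forall>x \<in> cyclic_cube q N.
           f x = (\<Sum>m \<in> multi_indices d q N. c m * character N m x)}"

definition Linf_norm :: "nat \<Rightarrow> nat \<Rightarrow> ((nat \<Rightarrow> complex) \<Rightarrow> complex) \<Rightarrow> real" where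
  "Linf_norm q N g = Max ((\<lambda>x. cmod (g x)) ` cyclic_cube q N)"

definition L2_norm :: "nat \<Rightarrow> nat \<Rightarrow> ((nat \<Rightarrow> complex) \<Rightarrow> complex) \<Rightarrow> real" where
  "L2_norm q N g = sqrt ((\<Sum>x \<in> cyclic_cube q N. (cmod (g x))\<^sup>2) / real q ^ N)"

text \<open>The law of \<open>M\<close> independent uniform points; the default value \<open>undefined\<close> is what
  \<open>Pi_pmf\<close> assigns at indices outside \<open>{..<M}\<close>.\<close>

definition iid_uniform :: "nat \<Rightarrow> nat \<Rightarrow> nat \<Rightarrow> (nat \<Rightarrow> nat \<Rightarrow> complex) pmf" where
  "iid_uniform q N M = Pi_pmf {..<M} undefined (\<lambda>_. pmf_of_set (cyclic_cube q N))"

definition sample_data ::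
    "nat \<Rightarrow> ((nat \<Rightarrow> complex) \<Rightarrow> complex) \<Rightarrow> (nat \<Rightarrow> nat \<Rightarrow> complex)
      \<Rightarrow> ((nat \<Rightarrow> complex) \<times> complex) list" where
  "sample_data M f X = map (\<lambda>j. (X j, f (X j))) [0..<M]"

text \<open>A learning algorithm is a rule turning sample data into a hypothesis; the hypothesis is
  random through the samples.\<close>

type_synonym learner =
  "((nat \<Rightarrow> complex) \<times> complex) list \<Rightarrow> ((nat \<Rightarrow> complex) \<Rightarrow> complex)"

end

theory Submission
  imports Defs
begin

text \<open>
  The learner computes empirical Fourier coefficients and keeps those of modulus at least \<open>2 \<eta>\<close>. By
  Hoeffding's inequality and a union bound all of them are \<open>\<eta>\<close>-accurate with probability at least
  \<open>1 - \<delta>\<close>, and then the squared \<open>L\<^sup>2\<close> error is at most \<open>9 \<Sum>\<^sub>m min (|c\<^sub>m|\<^sup>2) (\<eta>\<^sup>2)\<close>.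

  To bound this sum independently of the dimension, let \<open>w(j, s)\<close> be the \<open>L\<^sup>2\<close> norm of the part of \<open>f\<close>
  formed by the characters with exponent \<open>s \<noteq> 0\<close> at the coordinate \<open>j\<close>. Replacing each \<open>x\<^sub>j\<close> by \<open>y\<^sub>j\<close>
  independently with probability \<open>t\<close> turns the mean of \<open>f\<close> into a polynomial of degree at most \<open>d\<close> in
  \<open>t\<close> that is bounded on \<open>[0, 1]\<close>; its linear coefficient is the sum over \<open>j\<close> of the increments of
  \<open>f\<close> under the single replacements, which is therefore \<open>O(5\<^sup>d)\<close>. Since the \<open>L\<^sup>1\<close> and \<open>L\<^sup>2\<close> norms
  of functions of degree \<open>d - 1\<close> are comparable up to a factor \<open>(C q)^((d - 1) / 2)\<close>
  (hypercontractivity), the weights \<open>w(j, s)\<close> sum to at most \<open>A = (512 q)^(d / 2)\<close>. Only \<open>A / \<theta>\<close> of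
  them exceed \<open>\<theta>\<close>, so all but \<open>(1 + A / \<theta>)^d\<close> of the coefficients involve a weight at most \<open>\<theta>\<close>, and
  their squares sum to at most \<open>\<theta> A\<close>. Choosing \<open>\<theta>\<close> proportional to \<open>\<epsilon> / A\<close> makes \<open>A\<^sup>2 \<le> (512 q)^d\<close>
  enter the sample size to the power \<open>d\<close>; already \<open>D1(q) = O(sqrt q)\<close> would do.
\<close>

section \<open>Polynomials and counting\<close>

text \<open>An elementary substitute for Markov's inequality at the end point 0: each induction step
  lowers the degree by one, keeps the linear coefficient and multiplies the bound by 5. This
  exponential loss is affordable, since hypercontractivity costs a factor exponential in the degree
  as well.\<close>

lemma norm_coeff_1_le:
  fixes p :: "complex poly"
  assumes "degree p \<le> Suc d"
    and "\<And>t. 0 \<le> t \<Longrightarrow> t \<le> 1 \<Longrightarrow> norm (poly p (of_real t)) \<le> B"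
  shows "norm (coeff p 1) \<le> 2 * 5 ^ d * B"
  using assms
proof (induction d arbitrary: p B)
  case 0
  have p: "p = [:coeff p 0, coeff p 1:]"
    using 0(1) by (intro poly_eqI) (auto simp: coeff_pCons coeff_eq_0 split: nat.splits)
  have "coeff p 1 = poly p (of_real 1) - poly p (of_real 0)"
    by (subst (2 3) p) simp
  also have "norm \<dots> \<le> B + B"
    by (rule order_trans[OF norm_triangle_ineq4]) (intro add_mono 0(2); simp)
  finally show ?case by simp
next
  case (Suc d)
  \<comment> \<open>Richardson extrapolation: combining \<open>p (t / 2)\<close> with \<open>p t\<close> removes the leading term and keeps
    the linear one.\<close>
  define K :: real where "K = 2 ^ Suc d - 1"
  have K: "K \<ge> 1" using one_le_power[of "2::real" d] by (simp add: K_def)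
  define r where "r = smult (of_real (1 / K))
    (smult (2 ^ (d + 2)) (pcompose p [:0, 1 / 2:]) - p)"
  \<comment> \<open>The factor vanishes at \<open>i = d + 2\<close>, the largest possible degree of
    \<open>p\<close>, and the choice of \<open>K\<close> makes it 1 at \<open>i = 1\<close>.\<close>
  have cr: "coeff r i = of_real (1 / K) * (2 ^ (d + 2) / 2 ^ i - 1) * coeff p i" for i
  proof -
    have "a * (b * (1 / e * c) - c) = a * (b / e - 1) * c" for a b c e :: complex
      by (simp add: algebra_simps)
    then show ?thesis
      unfolding r_def coeff_smult coeff_diff coeff_pcompose_linear power_one_over .
  qed
  have B0: "B \<ge> 0" by (rule order_trans[OF norm_ge_zero Suc.prems(2)[of 0]]) auto
  have "coeff r i = 0" if "i > Suc d" for i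
  proof (cases "i = d + 2")
    case False
    then show ?thesis using that Suc.prems(1) by (simp add: cr coeff_eq_0)
  qed (simp add: cr)
  then have deg: "degree r \<le> Suc d" by (intro degree_le) auto
  have "norm (poly r (of_real t)) \<le> 5 * B" if t: "0 \<le> t" "t \<le> 1" for t
  proof -
    have "poly r (of_real t) =
        of_real (1 / K) * (2 ^ (d + 2) * poly p (of_real (t / 2)) - poly p (of_real t))"
      by (simp add: r_def poly_pcompose)
    also have "norm \<dots> = (1 / K) *
        norm (2 ^ (d + 2) * poly p (of_real (t / 2)) - poly p (of_real t))"
      using K by (simp add: norm_mult del: of_real_divide)
    also have "\<dots> \<le> (1 / K) * (2 ^ (d + 2) * B + B)"
    proof (rule mult_left_mono)
      show "norm (2 ^ (d + 2) * poly p (of_real (t / 2)) - poly p (of_real t))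
          \<le> 2 ^ (d + 2) * B + B"
        using Suc.prems(2)[of "t / 2"] Suc.prems(2)[of t] t
        by (intro order_trans[OF norm_triangle_ineq4] add_mono)
           (auto simp: norm_mult norm_power)
    qed (use K in simp)
    \<comment> \<open>\<open>2 ^ (d + 2) + 1\<close> is \<open>2 * K + 3\<close>, and
      \<open>K \<ge> 1\<close> bounds the quotient by 5.\<close>
    also have "\<dots> = B * ((2 * K + 3) / K)" by (simp add: K_def field_simps)
    also have "\<dots> \<le> B * 5"
      using K B0 by (intro mult_left_mono) (auto simp: divide_simps)
    finally show ?thesis by simp
  qed
  from Suc.IH[OF deg this] have "norm (coeff r 1) \<le> 2 * 5 ^ d * (5 * B)" .
  moreover have "coeff r 1 = coeff p 1"
  proof -
    have "complex_of_real (1 / K) * (2 ^ (d + 2) / 2 ^ 1 - 1) = of_real ((1 / K) * K)"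
      unfolding K_def by (simp only: of_real_mult) simp
    then show ?thesis using K by (simp only: cr) simp
  qed
  ultimately show ?case by (simp add: mult_ac)
qed

text \<open>Splitting into real and imaginary parts and then by sign leaves four pieces, each of
  them up to sign the real or imaginary part of a subset sum.\<close>

lemma sum_norm_le_of_subset_sums:
  fixes f :: "'a \<Rightarrow> complex"
  assumes "finite I" and sub: "\<And>J. J \<subseteq> I \<Longrightarrow> norm (sum f J) \<le> B"
  shows "(\<Sum>i\<in>I. norm (f i)) \<le> 4 * B"
proof -
  have *: "(\<Sum>i\<in>I. \<bar>h (f i)\<bar>) \<le> 2 * B"
    if lin: "\<And>J. h (sum f J) = (\<Sum>i\<in>J. h (f i))" and h: "\<And>z. \<bar>h z\<bar> \<le> norm z"
    for h :: "complex \<Rightarrow> real"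
  proof -
    let ?P = "{i \<in> I. h (f i) \<ge> 0}" and ?Q = "{i \<in> I. h (f i) < 0}"
    have "(\<Sum>i\<in>I. \<bar>h (f i)\<bar>) = (\<Sum>i\<in>?P \<union> ?Q. \<bar>h (f i)\<bar>)"
      by (rule sum.cong) auto
    also have "\<dots> = (\<Sum>i\<in>?P. \<bar>h (f i)\<bar>) + (\<Sum>i\<in>?Q. \<bar>h (f i)\<bar>)"
      using assms(1) by (intro sum.union_disjoint) auto
    also have "\<dots> = h (sum f ?P) - h (sum f ?Q)"
      by (simp add: lin sum_negf[symmetric])
    also have "\<dots> \<le> B + B"
      using h[of "sum f ?P"] h[of "sum f ?Q"] sub[of ?P] sub[of ?Q] by fastforce
    finally show ?thesis by simp
  qed
  have "(\<Sum>i\<in>I. norm (f i)) \<le> (\<Sum>i\<in>I. \<bar>Re (f i)\<bar> + \<bar>Im (f i)\<bar>)"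
    by (intro sum_mono cmod_le)
  also have "\<dots> = (\<Sum>i\<in>I. \<bar>Re (f i)\<bar>) + (\<Sum>i\<in>I. \<bar>Im (f i)\<bar>)" by (rule sum.distrib)
  also have "\<dots> \<le> 4 * B"
    using *[of Re] *[of Im] by (simp add: abs_Re_le_cmod abs_Im_le_cmod)
  finally show ?thesis .
qed

text \<open>The product rule at \<open>t = 0\<close>: each summand is \<open>b i - a i\<close> times
  the remaining \<open>a k\<close>, written as a difference of two products so that it becomes the
  increment of a character under one replacement.\<close>

lemma coeff_1_prod_linear:
  fixes a b :: "'i \<Rightarrow> 'a::comm_ring_1"
  assumes "finite S"
  shows "coeff (\<Prod>i\<in>S. [:a i, b i - a i:]) 1 =
    (\<Sum>i\<in>S. (\<Prod>k\<in>S. if k = i then b k else a k) - (\<Prod>k\<in>S. a k))"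
  using assms
proof (induction S rule: finite_induct)
  case (insert j S)
  let ?P = "\<lambda>i. \<Prod>k\<in>S. if k = i then b k else a k"
  have c0: "coeff (\<Prod>i\<in>S. [:a i, b i - a i:]) 0 = (\<Prod>k\<in>S. a k)"
    by (simp add: poly_0_coeff_0[symmetric] poly_prod)
  have j: "(\<Prod>k\<in>S. if k = j then b k else a k) = (\<Prod>k\<in>S. a k)"
    using insert by (intro prod.cong) auto
  have "(\<Sum>i\<in>S. (\<Prod>k\<in>insert j S. if k = i then b k else a k) - (\<Prod>k\<in>insert j S. a k))
      = (\<Sum>i\<in>S. a j * (?P i - (\<Prod>k\<in>S. a k)))"
    using insert by (intro sum.cong) (auto simp: algebra_simps)
  then show ?case
    using insert by (simp add: coeff_pCons c0 j sum_distrib_left algebra_simps)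
qed simp

text \<open>With \<open>n = card P\<close>, \<open>n choose k\<close> is at most
  \<open>n ^ k\<close>; inserting the factor \<open>d choose k \<ge> 1\<close> turns the sum into
  the binomial expansion of \<open>(n + 1) ^ d\<close>.\<close>

lemma card_small_subsets_le:
  assumes "finite P"
  shows "card {S. S \<subseteq> P \<and> card S \<le> d} \<le> (card P + 1) ^ d"
proof -
  have "{S. S \<subseteq> P \<and> card S \<le> d} = (\<Union>k\<le>d. {S. S \<subseteq> P \<and> card S = k})" by auto
  then have "card {S. S \<subseteq> P \<and> card S \<le> d} \<le> (\<Sum>k\<le>d. card {S. S \<subseteq> P \<and> card S = k})"
    by (simp add: card_UN_le)
  also have "\<dots> = (\<Sum>k\<le>d. card P choose k)" using assms by (simp add: n_subsets)
  also have "\<dots> \<le> (\<Sum>k\<le>d. (d choose k) * card P ^ k)"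
  proof (rule sum_mono)
    fix k assume k: "k \<in> {..d}"
    have "card P choose k \<le> card P ^ k"
      by (cases "k \<le> card P") (simp_all add: binomial_le_pow binomial_eq_0)
    moreover have "d choose k \<ge> 1" using k by (simp add: Suc_leI)
    ultimately show "card P choose k \<le> (d choose k) * card P ^ k"
      by (metis mult_le_mono mult_1)
  qed
  also have "\<dots> = (card P + 1) ^ d" by (subst binomial) simp
  finally show ?thesis .
qed

section \<open>Fourier analysis on the cyclic cube\<close>

lemma finite_roots_of_unity: "q > 0 \<Longrightarrow> finite (roots_of_unity q)"
  unfolding roots_of_unity_def by (rule finite_roots_unity) simp

lemma card_roots_of_unity: "q > 0 \<Longrightarrow> card (roots_of_unity q) = q"
  unfolding roots_of_unity_def by (rule card_roots_unity_eq)

lemma norm_roots_of_unity: "q > 0 \<Longrightarrow> z \<in> roots_of_unity q \<Longrightarrow> norm z = 1"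
  unfolding roots_of_unity_def using power_eq_1_iff by fastforce

text \<open>There are fewer than \<open>q\<close> roots of unity of order \<open>s\<close>, so some
  \<open>w\<close> in the group has \<open>w ^ s \<noteq> 1\<close>. Multiplication by
  \<open>w\<close> permutes the group and multiplies the sum by \<open>w ^ s\<close>.\<close>

lemma sum_power_roots_of_unity:
  assumes "0 < s" "s < q"
  shows "(\<Sum>z\<in>roots_of_unity q. z ^ s) = 0"
proof -
  let ?C = "roots_of_unity q"
  have "card {z::complex. z ^ s = 1} < card ?C"
    using assms card_roots_unity[of s] le_less_trans[OF _ assms(2)] by (simp add: card_roots_of_unity)
  then have "\<not> ?C \<subseteq> {z. z ^ s = 1}"
    using assms finite_roots_unity[of s] card_mono[of "{z::complex. z ^ s = 1}" ?C] by auto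
  then obtain w where w: "w \<in> ?C" "w ^ s \<noteq> 1" by auto
  have w0: "w \<noteq> 0" using w assms by (auto simp: roots_of_unity_def power_0_left)
  have "(\<Sum>z\<in>?C. z ^ s) = (\<Sum>z\<in>?C. (w * z) ^ s)"
    by (rule sum.reindex_bij_witness[of _ "\<lambda>z. w * z" "\<lambda>z. z / w"])
       (use w w0 in \<open>auto simp: roots_of_unity_def power_mult_distrib power_divide\<close>)
  also have "\<dots> = w ^ s * (\<Sum>z\<in>?C. z ^ s)"
    by (simp add: power_mult_distrib sum_distrib_left)
  finally show ?thesis using w(2) by auto
qed

lemma sum_roots_of_unity_orthogonal:
  assumes "a < q" "b < q"
  shows "(\<Sum>z\<in>roots_of_unity q. z ^ a * cnj (z ^ b)) = (if a = b then of_nat q else 0)"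
proof -
  have unit: "z ^ k * cnj (z ^ k) = 1" if "z \<in> roots_of_unity q" for z k
    using norm_roots_of_unity[OF _ that] assms
    by (simp add: complex_norm_square[symmetric] norm_power del: complex_cnj_power)
  \<comment> \<open>Conjugating the sum exchanges the two exponents, so one order suffices.\<close>
  have *: "(\<Sum>z\<in>roots_of_unity q. z ^ a * cnj (z ^ b)) = 0" if "a < b" "b < q" for a b
  proof -
    have "z ^ a * cnj (z ^ b) = cnj (z ^ (b - a))" if z: "z \<in> roots_of_unity q" for z
    proof -
      have "z ^ b = z ^ a * z ^ (b - a)" using \<open>a < b\<close> by (simp add: power_add[symmetric])
      then have "z ^ a * cnj (z ^ b) = (z ^ a * cnj (z ^ a)) * cnj (z ^ (b - a))"
        by (simp only: complex_cnj_mult mult.assoc)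
      then show ?thesis by (simp only: unit[OF z] mult_1_left)
    qed
    then have "(\<Sum>z\<in>roots_of_unity q. z ^ a * cnj (z ^ b)) =
        cnj (\<Sum>z\<in>roots_of_unity q. z ^ (b - a))"
      by (simp add: cnj_sum)
    then show ?thesis using that by (simp add: sum_power_roots_of_unity)
  qed
  consider "a < b" | "b < a" | "a = b" by linarith
  then show ?thesis
  proof cases
    case 2
    have "(\<Sum>z\<in>roots_of_unity q. z ^ a * cnj (z ^ b)) =
        cnj (\<Sum>z\<in>roots_of_unity q. z ^ b * cnj (z ^ a))"
      by (simp add: cnj_sum mult.commute)
    also have "\<dots> = 0" using *[OF 2 assms(1)] by (simp only: complex_cnj_zero)
    finally show ?thesis using 2 by simp
  next
    case 3
    then show ?thesis using unit assms by (simp add: card_roots_of_unity)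
  qed (use * assms in auto)
qed

lemma parseval_roots_of_unity:
  fixes b :: "nat \<Rightarrow> complex"
  assumes "q > 0"
  shows "(\<Sum>y\<in>roots_of_unity q. (norm (\<Sum>s<q. b s * y ^ s))\<^sup>2) = real q * (\<Sum>s<q. (norm (b s))\<^sup>2)"
proof -
  let ?C = "roots_of_unity q"
  have "complex_of_real (\<Sum>y\<in>?C. (norm (\<Sum>s<q. b s * y ^ s))\<^sup>2) =
      (\<Sum>y\<in>?C. \<Sum>s<q. \<Sum>t<q. b s * cnj (b t) * (y ^ s * cnj (y ^ t)))"
    by (simp add: complex_norm_square sum_product mult_ac del: of_real_power)
  also have "\<dots> = (\<Sum>s<q. \<Sum>t<q. b s * cnj (b t) * (\<Sum>y\<in>?C. y ^ s * cnj (y ^ t)))"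
    by (simp add: sum_distrib_left sum.swap[of _ _ ?C] del: complex_cnj_power)
  also have "\<dots> = (\<Sum>s<q. \<Sum>t<q. if s = t then of_nat q * (b s * cnj (b s)) else 0)"
    by (intro sum.cong refl) (auto simp: sum_roots_of_unity_orthogonal simp del: complex_cnj_power)
  also have "\<dots> = of_real (real q * (\<Sum>s<q. (norm (b s))\<^sup>2))"
    by (simp add: complex_norm_square sum_distrib_left del: of_real_power)
  finally show ?thesis using of_real_eq_iff by blast
qed

section \<open>Characters, averages and Parseval's identity on the cube\<close>

locale fourier_cube =
  fixes q N :: nat
  assumes q_ge_2: "q \<ge> 2"
begin

abbreviation "C \<equiv> roots_of_unity q"
abbreviation "X \<equiv> cyclic_cube q N"
abbreviation "\<phi> \<equiv> character N"

text \<open>All multi-indices, whatever their support: a degree bound is later imposed on the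
  coefficient family, so that functions of different degrees share one expansion
  \<open>ev\<close>.\<close>

definition indices :: "(nat \<Rightarrow> nat) set" where
  "indices = {..<N} \<rightarrow>\<^sub>E {0..<q}"

definition ev :: "((nat \<Rightarrow> nat) \<Rightarrow> complex) \<Rightarrow> (nat \<Rightarrow> complex) \<Rightarrow> complex" where
  "ev c x = (\<Sum>m\<in>indices. c m * \<phi> m x)"

definition avg :: "((nat \<Rightarrow> complex) \<Rightarrow> real) \<Rightarrow> real" where
  "avg F = (\<Sum>x\<in>X. F x) / real q ^ N"

lemma q_pos: "q > 0" using q_ge_2 by simp

lemmas fin_C [simp] = finite_roots_of_unity[OF q_pos]
lemmas card_C [simp] = card_roots_of_unity[OF q_pos]
lemmas norm_C = norm_roots_of_unity[OF q_pos]

lemma fin_X [simp]: "finite X" by (simp add: cyclic_cube_def finite_PiE)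

lemma card_X: "card X = q ^ N" by (simp add: cyclic_cube_def card_PiE)

lemma X_nonempty: "X \<noteq> {}" using card_X q_pos by force

lemma fin_indices [simp]: "finite indices" by (simp add: indices_def finite_PiE)

lemma X_upd: "x \<in> X \<Longrightarrow> j < N \<Longrightarrow> y \<in> C \<Longrightarrow> x(j := y) \<in> X"
  by (auto simp: cyclic_cube_def PiE_iff extensional_def)

lemma X_D: "x \<in> X \<Longrightarrow> j < N \<Longrightarrow> x j \<in> C"
  unfolding cyclic_cube_def by (drule PiE_mem[where x = j]) auto

lemma indices_upd: "m \<in> indices \<Longrightarrow> j < N \<Longrightarrow> s < q \<Longrightarrow> m(j := s) \<in> indices"
  by (auto simp: indices_def PiE_iff extensional_def)

lemma indices_D: "m \<in> indices \<Longrightarrow> j < N \<Longrightarrow> m j < q"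
  unfolding indices_def by (drule PiE_mem[where x = j]) auto

lemma norm_character: "x \<in> X \<Longrightarrow> norm (\<phi> m x) = 1"
  by (simp add: character_def prod_norm[symmetric] norm_power norm_C X_D)

lemma avg_const [simp]: "avg (\<lambda>_. c) = c"
  using q_pos by (simp add: avg_def card_X)

lemma avg_add: "avg (\<lambda>x. F x + G x) = avg F + avg G"
  by (simp add: avg_def sum.distrib add_divide_distrib)

lemma avg_cmult: "avg (\<lambda>x. c * F x) = c * avg F"
  by (simp add: avg_def sum_distrib_left)

lemma avg_sum: "avg (\<lambda>x. \<Sum>i\<in>I. F i x) = (\<Sum>i\<in>I. avg (F i))"
  by (simp add: avg_def sum.swap[of _ I] sum_divide_distrib)

lemma avg_mono: "(\<And>x. x \<in> X \<Longrightarrow> F x \<le> G x) \<Longrightarrow> avg F \<le> avg G"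
  by (auto simp: avg_def intro!: divide_right_mono sum_mono)

lemma avg_cong: "(\<And>x. x \<in> X \<Longrightarrow> F x = G x) \<Longrightarrow> avg F = avg G"
  by (auto simp: avg_def)

lemma avg_nonneg: "(\<And>x. x \<in> X \<Longrightarrow> F x \<ge> 0) \<Longrightarrow> avg F \<ge> 0"
  by (auto simp: avg_def intro!: divide_nonneg_nonneg sum_nonneg)

lemma avg_mult_le:
  "avg (\<lambda>x. F x * G x) \<le> sqrt (avg (\<lambda>x. (F x)\<^sup>2)) * sqrt (avg (\<lambda>x. (G x)\<^sup>2))"
proof -
  have *: "(\<Sum>x\<in>X. F x * G x) \<le> sqrt (\<Sum>x\<in>X. (F x)\<^sup>2) * sqrt (\<Sum>x\<in>X. (G x)\<^sup>2)"
    using Cauchy_Schwarz_ineq_sum[of F G X]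
    by (metis real_le_rsqrt real_sqrt_mult)
  have "sqrt (avg (\<lambda>x. (F x)\<^sup>2)) * sqrt (avg (\<lambda>x. (G x)\<^sup>2)) =
      sqrt (\<Sum>x\<in>X. (F x)\<^sup>2) * sqrt (\<Sum>x\<in>X. (G x)\<^sup>2) / real q ^ N"
    by (simp add: avg_def real_sqrt_divide)
  then show ?thesis using * by (simp add: avg_def divide_right_mono)
qed

text \<open>The map \<open>(x, y) \<mapsto> (x(j := y), x j)\<close> is an involution of
  \<open>X \<times> C\<close>; hence resampling one coordinate preserves the uniform law.\<close>

lemma avg_resample:
  assumes "j < N"
  shows "(\<Sum>y\<in>C. avg (\<lambda>x. F (x(j := y)))) / real q = avg F"
proof -
  have "(\<Sum>y\<in>C. \<Sum>x\<in>X. F (x(j := y))) = (\<Sum>(x, y)\<in>X \<times> C. F (x(j := y)))"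
    by (subst sum.swap) (simp add: sum.cartesian_product)
  also have "\<dots> = (\<Sum>(x, y)\<in>X \<times> C. F x)"
    by (rule sum.reindex_bij_witness[of _ "\<lambda>(x, y). (x(j := y), x j)" "\<lambda>(x, y). (x(j := y), x j)"])
       (use assms in \<open>auto simp: X_upd X_D\<close>)
  also have "\<dots> = real q * (\<Sum>x\<in>X. F x)"
    by (simp add: sum.cartesian_product[symmetric] sum_distrib_left)
  finally show ?thesis
    using q_pos by (simp add: avg_def sum_divide_distrib[symmetric])
qed

lemma character_orthogonal:
  assumes "m \<in> indices" "n \<in> indices"
  shows "(\<Sum>x\<in>X. \<phi> m x * cnj (\<phi> n x)) = (if m = n then of_nat q ^ N else 0)"
proof -
  have "(\<Sum>x\<in>X. \<phi> m x * cnj (\<phi> n x)) = (\<Sum>x\<in>X. \<Prod>j<N. x j ^ m j * cnj (x j ^ n j))"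
    by (simp add: character_def cnj_prod prod.distrib)
  also have "\<dots> = (\<Prod>j<N. \<Sum>z\<in>C. z ^ m j * cnj (z ^ n j))"
    unfolding cyclic_cube_def by (subst prod_sum_PiE) auto
  also have "\<dots> = (\<Prod>j<N. if m j = n j then of_nat q else 0)"
    using assms by (intro prod.cong) (auto simp: sum_roots_of_unity_orthogonal indices_D simp del: complex_cnj_power)
  also have "\<dots> = (if m = n then of_nat q ^ N else 0)"
  proof (cases "m = n")
    case False
    then obtain j where "j < N" "m j \<noteq> n j"
      using assms by (metis indices_def PiE_ext lessThan_iff)
    then show ?thesis using False by (auto intro!: prod_zero)
  qed simp
  finally show ?thesis .
qed

lemma sum_ev_character:
  assumes "n \<in> indices"
  shows "(\<Sum>x\<in>X. ev c x * cnj (\<phi> n x)) = of_nat q ^ N * c n"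
proof -
  have "(\<Sum>x\<in>X. ev c x * cnj (\<phi> n x)) = (\<Sum>m\<in>indices. c m * (\<Sum>x\<in>X. \<phi> m x * cnj (\<phi> n x)))"
    by (simp add: ev_def sum_distrib_left sum_distrib_right mult.assoc sum.swap[of _ indices X])
  also have "\<dots> = (\<Sum>m\<in>indices. if m = n then of_nat q ^ N * c m else 0)"
    using assms by (intro sum.cong) (auto simp: character_orthogonal)
  finally show ?thesis using assms by (simp add: sum.delta)
qed

lemma parseval: "avg (\<lambda>x. (norm (ev c x))\<^sup>2) = (\<Sum>m\<in>indices. (norm (c m))\<^sup>2)"
proof -
  have "complex_of_real (\<Sum>x\<in>X. (norm (ev c x))\<^sup>2) = (\<Sum>x\<in>X. ev c x * cnj (ev c x))"
    by (simp add: complex_norm_square del: of_real_power)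
  also have "\<dots> = (\<Sum>x\<in>X. \<Sum>n\<in>indices. cnj (c n) * (ev c x * cnj (\<phi> n x)))"
    by (intro sum.cong refl) (simp add: ev_def[of c] sum_distrib_left mult_ac)
  also have "\<dots> = (\<Sum>n\<in>indices. cnj (c n) * (\<Sum>x\<in>X. ev c x * cnj (\<phi> n x)))"
    by (subst sum.swap) (simp add: sum_distrib_left)
  also have "\<dots> = of_real (real q ^ N * (\<Sum>n\<in>indices. (norm (c n))\<^sup>2))"
  proof -
    have "cnj (c n) * (\<Sum>x\<in>X. ev c x * cnj (\<phi> n x)) = of_real (real q ^ N * (norm (c n))\<^sup>2)"
      if "n \<in> indices" for n
    proof -
      have "cnj (c n) * (of_nat q ^ N * c n) = of_nat q ^ N * (c n * cnj (c n))" by simp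
      then show ?thesis
        by (simp add: sum_ev_character[OF that] complex_norm_square[symmetric])
    qed
    then show ?thesis by (simp add: sum_distrib_left)
  qed
  finally have "(\<Sum>x\<in>X. (norm (ev c x))\<^sup>2) = real q ^ N * (\<Sum>n\<in>indices. (norm (c n))\<^sup>2)"
    using of_real_eq_iff by blast
  then show ?thesis using q_pos by (simp add: avg_def)
qed

end

section \<open>Hypercontractivity\<close>

text \<open>The fourth power is \<open>(A + B + 2 * r)\<^sup>2\<close> with
  \<open>r\<^sup>2 \<le> A * B\<close>. The term \<open>4 * B * r\<close> is absorbed by the
  arithmetic-geometric mean inequality, whereas \<open>4 * A * r\<close> is kept, because it will
  cancel on averaging over the resampled coordinate.\<close>

lemma norm_add_power4_le:
  fixes a b :: complex
  shows "norm (a + b) ^ 4 \<le> norm a ^ 4 + 8 * ((norm a)\<^sup>2 * (norm b)\<^sup>2) + 3 * norm b ^ 4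
    + 4 * (norm a)\<^sup>2 * Re (a * cnj b)"
proof -
  define A B r where "A = (norm a)\<^sup>2" and "B = (norm b)\<^sup>2" and "r = Re (a * cnj b)"
  have "r\<^sup>2 \<le> (norm (a * cnj b))\<^sup>2"
    using abs_Re_le_cmod[of "a * cnj b"] by (simp add: r_def abs_le_square_iff[symmetric])
  then have r: "r\<^sup>2 \<le> A * B" by (simp add: A_def B_def norm_mult power_mult_distrib)
  have "(norm (a + b))\<^sup>2 = A + B + 2 * r"
    unfolding A_def B_def r_def cmod_power2 by (simp add: power2_eq_square algebra_simps)
  then have "norm (a + b) ^ 4 = (A + B + 2 * r)\<^sup>2"
    by (metis power_even_eq[of _ 2] mult_2 numeral_Bit0)
  also have "\<dots> \<le> A\<^sup>2 + 8 * (A * B) + 3 * B\<^sup>2 + 4 * A * r"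
    using r zero_le_power2[of "B - r"] by (simp add: power2_eq_square algebra_simps)
  finally show ?thesis by (simp add: A_def B_def r_def power_even_eq[of _ 2, simplified])
qed

context fourier_cube
begin

section \<open>Degree and slices along one coordinate\<close>

definition supp :: "(nat \<Rightarrow> nat) \<Rightarrow> nat set" where
  "supp m = {j \<in> {..<N}. m j \<noteq> 0}"

definition deg_le :: "nat \<Rightarrow> ((nat \<Rightarrow> nat) \<Rightarrow> complex) \<Rightarrow> bool" where
  "deg_le d c \<longleftrightarrow> (\<forall>m\<in>indices. c m \<noteq> 0 \<longrightarrow> card (supp m) \<le> d)"

text \<open>The coefficients of the factor that multiplies \<open>x j ^ s\<close> when the function
  is written as a polynomial in \<open>x j\<close>; this factor no longer depends on the coordinate
  \<open>j\<close>.\<close>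

definition slice :: "nat \<Rightarrow> nat \<Rightarrow> ((nat \<Rightarrow> nat) \<Rightarrow> complex) \<Rightarrow> (nat \<Rightarrow> nat) \<Rightarrow> complex" where
  "slice j s c m = (if m j = 0 then c (m(j := s)) else 0)"

lemma finite_supp [simp]: "finite (supp m)" by (simp add: supp_def)

lemma supp_upd: "j < N \<Longrightarrow> supp (m(j := s)) = (if s = 0 then supp m - {j} else insert j (supp m))"
  by (auto simp: supp_def)

lemma ev_sum: "ev (\<lambda>m. \<Sum>i\<in>I. a i * c i m) x = (\<Sum>i\<in>I. a i * ev (c i) x)"
  by (simp add: ev_def sum_distrib_left sum_distrib_right sum.swap[of _ I] mult.assoc)

lemma character_upd:
  assumes "j < N"
  shows "\<phi> m (x(j := y)) = \<phi> (m(j := 0)) x * y ^ m j"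
proof -
  have "\<phi> m (x(j := y)) = y ^ m j * (\<Prod>i\<in>{..<N} - {j}. x i ^ m i)"
    using assms by (simp add: character_def prod.remove[of _ j])
  moreover have "\<phi> (m(j := 0)) x = (\<Prod>i\<in>{..<N} - {j}. x i ^ m i)"
    using assms by (simp add: character_def prod.remove[of _ j])
  ultimately show ?thesis by simp
qed

lemma sum_indices_split:
  assumes "j < N"
  shows "(\<Sum>m\<in>indices. F m) = (\<Sum>s<q. \<Sum>m\<in>{m\<in>indices. m j = 0}. F (m(j := s)))"
proof -
  have "(\<Sum>s<q. \<Sum>m\<in>{m\<in>indices. m j = 0}. F (m(j := s))) =
      (\<Sum>(s, m)\<in>{..<q} \<times> {m\<in>indices. m j = 0}. F (m(j := s)))"
    by (simp add: sum.cartesian_product)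
  also have "\<dots> = (\<Sum>m\<in>indices. F m)"
    by (rule sum.reindex_bij_witness[of _ "\<lambda>m. (m j, m(j := 0))" "\<lambda>(s, m). m(j := s)"])
       (use assms q_pos in \<open>auto simp: indices_upd indices_D fun_upd_idem\<close>)
  finally show ?thesis by simp
qed

lemma ev_slice: "ev (slice j s c) x = (\<Sum>m\<in>{m\<in>indices. m j = 0}. c (m(j := s)) * \<phi> m x)"
  unfolding ev_def by (rule sum.mono_neutral_cong_right) (auto simp: slice_def)

lemma ev_upd:
  assumes "j < N"
  shows "ev c (x(j := y)) = (\<Sum>s<q. ev (slice j s c) x * y ^ s)"
  unfolding ev_slice sum_distrib_right unfolding ev_def
  by (subst sum_indices_split[OF assms], intro sum.cong refl)
     (auto simp: character_upd assms fun_upd_idem)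

lemma deg_le_slice:
  assumes "deg_le d c" "j < N" "0 < s" "s < q"
  shows "deg_le (d - 1) (slice j s c)"
  unfolding deg_le_def
proof (intro ballI impI)
  fix m assume m: "m \<in> indices" "slice j s c m \<noteq> 0"
  then have "m j = 0" "c (m(j := s)) \<noteq> 0" by (auto simp: slice_def split: if_splits)
  then have "card (insert j (supp m)) \<le> d"
    using assms m by (auto simp: deg_le_def supp_upd dest!: bspec[of _ _ "m(j := s)"] intro: indices_upd)
  moreover have "j \<notin> supp m" using \<open>m j = 0\<close> by (simp add: supp_def)
  ultimately show "card (supp m) \<le> d - 1" by simp
qed

text \<open>Induction over the coordinates that may occur, with the degree left free. Resampling the
  coordinate \<open>j\<close> writes the function as \<open>g + H y\<close>, where \<open>g\<close>
  omits \<open>j\<close> and \<open>H y\<close> loses one degree as well. Since \<open>H y\<close>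
  sums to 0 over \<open>y\<close>, the odd cross term disappears, and the factor
  \<open>16 * q\<close> gained from the smaller degree pays for the remaining constants.\<close>

lemma hypercontractivity_supported:
  assumes "finite J" "\<And>m. m \<in> indices \<Longrightarrow> c m \<noteq> 0 \<Longrightarrow> supp m \<subseteq> J" "deg_le d c"
  shows "avg (\<lambda>x. norm (ev c x) ^ 4) \<le> (16 * real q) ^ d * (avg (\<lambda>x. (norm (ev c x))\<^sup>2))\<^sup>2"
  using assms
proof (induction J arbitrary: c d rule: finite_induct)
  case empty
  define z :: "nat \<Rightarrow> nat" where "z = (\<lambda>j\<in>{..<N}. 0)"
  have z: "m = z" if "m \<in> indices" "supp m = {}" for m
    using that by (auto simp: indices_def supp_def z_def PiE_iff extensional_def fun_eq_iff)
  have zi: "z \<in> indices" using q_pos by (auto simp: z_def indices_def)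
  have "ev c x = c z" for x
  proof -
    have "ev c x = (\<Sum>m\<in>{z}. c m * \<phi> m x)"
      unfolding ev_def
    proof (rule sum.mono_neutral_right)
      show "\<forall>m\<in>indices - {z}. c m * \<phi> m x = 0"
        using z empty(1) by (metis Diff_iff insertI1 mult_zero_left subset_empty)
    qed (use zi in auto)
    then show ?thesis by (simp add: character_def z_def)
  qed
  moreover have "1 * norm (c z) ^ 4 \<le> (16 * real q) ^ d * norm (c z) ^ 4"
    using q_pos by (intro mult_right_mono one_le_power) auto
  ultimately show ?case by (simp add: power_even_eq[of _ 2, simplified])
next
  case (insert j J)
  show ?case
  proof (cases "j < N \<and> d > 0")
    \<comment> \<open>There is nothing to resample: for \<open>d = 0\<close> all supports are empty,
      and for \<open>j \<ge> N\<close> no support contains \<open>j\<close>.\<close>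
    case False
    have "supp m \<subseteq> J" if "m \<in> indices" "c m \<noteq> 0" for m
    proof (cases "d = 0")
      case True
      then show ?thesis using insert.prems(2) that by (auto simp: deg_le_def)
    next
      case d: False
      then show ?thesis using False insert.prems(1)[OF that] by (auto simp: supp_def)
    qed
    then show ?thesis using insert.IH insert.prems(2) by blast
  next
    case True
    then obtain e where d: "d = Suc e" and j: "j < N" using gr0_conv_Suc by auto
    define \<kappa> where "\<kappa> = 16 * real q"
    have k: "\<kappa> \<ge> 16" using q_pos by (simp add: \<kappa>_def)
    define g where "g = ev (slice j 0 c)"
    define H where "H y = ev (\<lambda>m. \<Sum>s\<in>{1..<q}. y ^ s * slice j s c m)" for y
    define G2 where "G2 = avg (\<lambda>x. (norm (g x))\<^sup>2)"
    define G4 where "G4 = avg (\<lambda>x. norm (g x) ^ 4)"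
    define H2 where "H2 y = avg (\<lambda>x. (norm (H y x))\<^sup>2)" for y
    define H4 where "H4 y = avg (\<lambda>x. norm (H y x) ^ 4)" for y
    define cr where "cr x y = Re (g x * cnj (H y x))" for x y
    define h where "h = (\<Sum>y\<in>C. H2 y) / real q"
    have G2_0: "G2 \<ge> 0" unfolding G2_def by (rule avg_nonneg) simp
    have H2_0: "H2 y \<ge> 0" for y unfolding H2_def by (rule avg_nonneg) simp
    have H4_0: "H4 y \<ge> 0" for y unfolding H4_def by (rule avg_nonneg) simp
    have f: "ev c (x(j := y)) = g x + H y x" for x y
    proof -
      have "{..<q} = insert 0 {1..<q}" using q_pos by auto
      then show ?thesis
        by (simp add: ev_upd[OF j] g_def H_def ev_sum mult.commute)
    qed
    have sumH: "(\<Sum>y\<in>C. H y x) = 0" for x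
    proof -
      have "(\<Sum>y\<in>C. H y x) = (\<Sum>s\<in>{1..<q}. (\<Sum>y\<in>C. y ^ s) * ev (slice j s c) x)"
        by (simp add: H_def ev_sum sum_distrib_right sum.swap[of _ C])
      also have "\<dots> = 0" by (simp add: sum_power_roots_of_unity)
      finally show ?thesis .
    qed
    have sumcr: "(\<Sum>y\<in>C. cr x y) = 0" for x
    proof -
      have "(\<Sum>y\<in>C. cr x y) = Re (g x * cnj (\<Sum>y\<in>C. H y x))"
        by (simp add: cr_def sum_distrib_left)
      then show ?thesis by (simp add: sumH)
    qed
    have G4: "G4 \<le> \<kappa> ^ Suc e * G2\<^sup>2"
      unfolding G4_def G2_def g_def \<kappa>_def
    proof (rule insert.IH)
      have *: "m(j := 0) = m" if "slice j 0 c m \<noteq> 0" for m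
        using that by (auto simp: slice_def fun_upd_idem split: if_splits)
      show "supp m \<subseteq> J" if "m \<in> indices" "slice j 0 c m \<noteq> 0" for m
        using insert.prems(1)[of m] that *[OF that(2)] by (auto simp: slice_def supp_def split: if_splits)
      show "deg_le (Suc e) (slice j 0 c)"
        using insert.prems(2) * unfolding deg_le_def d by (metis slice_def)
    qed
    have H4: "H4 y \<le> \<kappa> ^ e * (H2 y)\<^sup>2" for y
      unfolding H4_def H2_def H_def \<kappa>_def
    proof (rule insert.IH)
      have nz: "\<exists>s. 0 < s \<and> s < q \<and> slice j s c m \<noteq> 0"
        if "(\<Sum>s\<in>{1..<q}. y ^ s * slice j s c m) \<noteq> 0" for m
        using that by (rule contrapos_np) (auto intro!: sum.neutral)
      show "supp m \<subseteq> J" if m: "m \<in> indices" "(\<Sum>s\<in>{1..<q}. y ^ s * slice j s c m) \<noteq> 0" for m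
      proof -
        obtain s where s: "0 < s" "s < q" "m j = 0" "c (m(j := s)) \<noteq> 0"
          using nz[OF m(2)] by (auto simp: slice_def split: if_splits)
        have "supp (m(j := s)) \<subseteq> insert j J"
          by (rule insert.prems(1)[OF indices_upd[OF m(1) j s(2)] s(4)])
        then show ?thesis using s j by (auto simp: supp_upd supp_def)
      qed
      show "deg_le e (\<lambda>m. \<Sum>s\<in>{1..<q}. y ^ s * slice j s c m)"
        unfolding deg_le_def
      proof (intro ballI impI)
        fix m assume m: "m \<in> indices" "(\<Sum>s\<in>{1..<q}. y ^ s * slice j s c m) \<noteq> 0"
        obtain s where s: "0 < s" "s < q" "slice j s c m \<noteq> 0" using nz[OF m(2)] by auto
        then show "card (supp m) \<le> e"
          using deg_le_slice[OF insert.prems(2) j s(1,2)] m(1) by (simp add: deg_le_def d)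
      qed
    qed
    \<comment> \<open>Cauchy-Schwarz reduces the mixed term to fourth moments;
      \<open>\<kappa> \<ge> 16\<close> makes it fit the cross term of
      \<open>\<kappa> ^ d * (G2 + h)\<^sup>2\<close>.\<close>
    have mixed: "8 * avg (\<lambda>x. (norm (g x))\<^sup>2 * (norm (H y x))\<^sup>2) \<le> 2 * \<kappa> ^ Suc e * (G2 * H2 y)" for y
    proof -
      have "avg (\<lambda>x. (norm (g x))\<^sup>2 * (norm (H y x))\<^sup>2) \<le> sqrt G4 * sqrt (H4 y)"
        using avg_mult_le[of "\<lambda>x. (norm (g x))\<^sup>2" "\<lambda>x. (norm (H y x))\<^sup>2"]
        by (simp add: G4_def H4_def)
      also have "\<dots> \<le> sqrt (\<kappa> ^ Suc e * G2\<^sup>2) * sqrt (\<kappa> ^ e * (H2 y)\<^sup>2)"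
        using G4 H4 H4_0 k G2_0 by (intro mult_mono real_sqrt_le_mono) auto
      also have "\<dots> = sqrt (\<kappa> ^ Suc e * \<kappa> ^ e) * (G2 * H2 y)"
        using G2_0 H2_0 by (simp add: real_sqrt_mult)
      also have "\<dots> \<le> \<kappa> ^ Suc e / 4 * (G2 * H2 y)"
      proof (intro mult_right_mono)
        have "\<kappa> ^ Suc e * (16 * \<kappa> ^ e) \<le> \<kappa> ^ Suc e * \<kappa> ^ Suc e"
          using k by (intro mult_left_mono) (auto intro: mult_right_mono)
        then show "sqrt (\<kappa> ^ Suc e * \<kappa> ^ e) \<le> \<kappa> ^ Suc e / 4"
          using k by (intro real_le_lsqrt) (auto simp: power2_eq_square)
      qed (use G2_0 H2_0 in auto)
      finally show ?thesis by (simp add: mult_ac del: power_Suc)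
    qed
    have each: "avg (\<lambda>x. norm (ev c (x(j := y))) ^ 4) \<le> \<kappa> ^ Suc e * G2\<^sup>2 + 2 * \<kappa> ^ Suc e * G2 * H2 y
        + 3 * \<kappa> ^ e * (H2 y)\<^sup>2 + avg (\<lambda>x. 4 * (norm (g x))\<^sup>2 * cr x y)" for y
    proof -
      have "avg (\<lambda>x. norm (ev c (x(j := y))) ^ 4) \<le>
          avg (\<lambda>x. norm (g x) ^ 4 + 8 * ((norm (g x))\<^sup>2 * (norm (H y x))\<^sup>2) + 3 * norm (H y x) ^ 4
            + 4 * (norm (g x))\<^sup>2 * cr x y)"
        unfolding f cr_def by (intro avg_mono norm_add_power4_le)
      also have "\<dots> = G4 + 8 * avg (\<lambda>x. (norm (g x))\<^sup>2 * (norm (H y x))\<^sup>2) + 3 * H4 y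
          + avg (\<lambda>x. 4 * (norm (g x))\<^sup>2 * cr x y)"
        by (simp only: avg_add avg_cmult G4_def H4_def)
      also have "\<dots> \<le> \<kappa> ^ Suc e * G2\<^sup>2 + 2 * \<kappa> ^ Suc e * G2 * H2 y
        + 3 * \<kappa> ^ e * (H2 y)\<^sup>2 + avg (\<lambda>x. 4 * (norm (g x))\<^sup>2 * cr x y)"
        using G4 mixed[of y] H4[of y] by (simp add: mult_ac del: power_Suc)
      finally show ?thesis .
    qed
    have crsum: "(\<Sum>y\<in>C. avg (\<lambda>x. F x * cr x y)) = 0" for F
      by (simp add: avg_sum[symmetric] sum_distrib_left[symmetric] sumcr)
    have h0: "h \<ge> 0" unfolding h_def by (intro divide_nonneg_nonneg sum_nonneg H2_0) simp
    have sumH2: "(\<Sum>y\<in>C. H2 y) = real q * h" using q_pos by (simp add: h_def)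
    have avg2: "avg (\<lambda>x. (norm (ev c x))\<^sup>2) = G2 + h"
    proof -
      have "(norm (g x + H y x))\<^sup>2 = (norm (g x))\<^sup>2 + (norm (H y x))\<^sup>2 + 2 * cr x y" for x y
        unfolding cr_def cmod_power2 by (simp add: power2_eq_square algebra_simps)
      then have "avg (\<lambda>x. (norm (ev c x))\<^sup>2) = (\<Sum>y\<in>C. G2 + H2 y + avg (\<lambda>x. 2 * cr x y)) / real q"
        by (subst avg_resample[OF j, symmetric]) (simp add: f avg_add G2_def H2_def)
      also have "\<dots> = G2 + h"
        using q_pos by (simp add: sum.distrib crsum[of "\<lambda>_. 2"] sumH2 field_simps)
      finally show ?thesis .
    qed
    \<comment> \<open>For nonnegative terms the sum of squares is at most the square of the sum.
      After division by \<open>q\<close> this loses a factor \<open>q\<close>, which is why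
      \<open>\<kappa>\<close> is proportional to \<open>q\<close>.\<close>
    have H2sq: "(\<Sum>y\<in>C. (H2 y)\<^sup>2) \<le> (real q * h)\<^sup>2"
    proof -
      have "(\<Sum>y\<in>C. (H2 y)\<^sup>2) \<le> (\<Sum>y\<in>C. H2 y * (\<Sum>y\<in>C. H2 y))"
        unfolding power2_eq_square
        by (intro sum_mono mult_left_mono member_le_sum H2_0) auto
      then show ?thesis by (simp add: sum_distrib_right[symmetric] sumH2 power2_eq_square)
    qed
    have "avg (\<lambda>x. norm (ev c x) ^ 4) \<le> (\<Sum>y\<in>C. \<kappa> ^ Suc e * G2\<^sup>2 + 2 * \<kappa> ^ Suc e * G2 * H2 y
        + 3 * \<kappa> ^ e * (H2 y)\<^sup>2 + avg (\<lambda>x. 4 * (norm (g x))\<^sup>2 * cr x y)) / real q"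
      by (subst avg_resample[OF j, symmetric]) (intro divide_right_mono sum_mono each, simp)
    also have "\<dots> = (real q * (\<kappa> ^ Suc e * G2\<^sup>2) + 2 * \<kappa> ^ Suc e * G2 * (real q * h)
        + 3 * \<kappa> ^ e * (\<Sum>y\<in>C. (H2 y)\<^sup>2)) / real q"
      by (simp add: sum.distrib crsum sumH2[symmetric] sum_distrib_left[symmetric] del: power_Suc)
    also have "\<dots> \<le> (real q * (\<kappa> ^ Suc e * G2\<^sup>2) + 2 * \<kappa> ^ Suc e * G2 * (real q * h)
        + 3 * \<kappa> ^ e * (real q * h)\<^sup>2) / real q"
      using H2sq k by (intro divide_right_mono add_left_mono mult_left_mono) auto
    also have "\<dots> = \<kappa> ^ e * (\<kappa> * G2\<^sup>2 + 2 * \<kappa> * G2 * h + 3 * real q * h\<^sup>2)"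
      using q_pos by (simp add: field_simps power2_eq_square)
    also have "\<dots> \<le> \<kappa> ^ e * (\<kappa> * G2\<^sup>2 + 2 * \<kappa> * G2 * h + \<kappa> * h\<^sup>2)"
      using k by (intro mult_left_mono add_left_mono mult_right_mono) (auto simp: \<kappa>_def)
    also have "\<dots> = \<kappa> ^ d * (G2 + h)\<^sup>2"
      by (simp add: d power2_eq_square algebra_simps)
    finally show ?thesis by (simp only: avg2 \<kappa>_def)
  qed
qed

text \<open>Small values of the modulus are controlled by the first moment and large ones by the
  fourth, which hypercontractivity bounds by the square of the second.\<close>

lemma norm_2_le_norm_1:
  assumes "deg_le d c"
  shows "avg (\<lambda>x. (norm (ev c x))\<^sup>2) \<le> 8 * (16 * real q) ^ d * (avg (\<lambda>x. norm (ev c x)))\<^sup>2"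
proof -
  define B where "B = avg (\<lambda>x. (norm (ev c x))\<^sup>2)"
  define K where "K = (16 * real q) ^ d"
  define E where "E = avg (\<lambda>x. norm (ev c x))"
  have K: "K > 0" using q_pos by (simp add: K_def)
  have B0: "B \<ge> 0" unfolding B_def by (rule avg_nonneg) simp
  have H: "avg (\<lambda>x. norm (ev c x) ^ 4) \<le> K * B\<^sup>2"
    unfolding K_def B_def
    by (rule hypercontractivity_supported[of "{..<N}"]) (use assms in \<open>auto simp: supp_def\<close>)
  show ?thesis
  proof (cases "B = 0")
    case False
    \<comment> \<open>With this truncation level the fourth moment contributes at most
      \<open>B / 2\<close>, which is moved to the left-hand side.\<close>
    define t where "t = sqrt (2 * K * B)"
    have t: "t > 0" "t\<^sup>2 = 2 * K * B" using K B0 False by (auto simp: t_def)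
    have pt: "a\<^sup>2 \<le> t * a + 1 / t\<^sup>2 * a ^ 4" if "a \<ge> 0" for a
    proof (cases "a \<le> t")
      case True
      then have "a * a \<le> t * a" using that by (rule mult_right_mono)
      then show ?thesis using that by (simp add: power2_eq_square add_increasing2)
    next
      case False
      then have "t\<^sup>2 * a\<^sup>2 \<le> a\<^sup>2 * a\<^sup>2" using t by (intro mult_right_mono power_mono) auto
      then have "a\<^sup>2 \<le> 1 / t\<^sup>2 * a ^ 4"
        using t(1) by (simp add: field_simps power2_eq_square power4_eq_xxxx)
      moreover have "t * a \<ge> 0" using t(1) that by simp
      ultimately show ?thesis by linarith
    qed
    have "B \<le> avg (\<lambda>x. t * norm (ev c x) + 1 / t\<^sup>2 * norm (ev c x) ^ 4)"
      unfolding B_def by (intro avg_mono pt) simp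
    also have "\<dots> = t * E + 1 / t\<^sup>2 * avg (\<lambda>x. norm (ev c x) ^ 4)"
      by (simp only: avg_add avg_cmult E_def)
    also have "\<dots> \<le> t * E + 1 / t\<^sup>2 * (K * B\<^sup>2)"
      using H by (intro add_left_mono mult_left_mono) auto
    also have "1 / t\<^sup>2 * (K * B\<^sup>2) = B / 2"
      using K False unfolding t(2) by (simp add: power2_eq_square)
    finally have "B / 2 \<le> t * E" by simp
    then have "(B / 2)\<^sup>2 \<le> (t * E)\<^sup>2" using B0 by (intro power_mono) auto
    then have "B\<^sup>2 / 4 \<le> 2 * K * B * E\<^sup>2"
      by (simp add: power_mult_distrib t(2) power_divide)
    then have "B * B \<le> B * (8 * K * E\<^sup>2)"
      by (simp add: power2_eq_square algebra_simps)
    then have "B \<le> 8 * K * E\<^sup>2" using False B0 by (simp add: mult_le_cancel_left)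
    then show ?thesis by (simp only: B_def K_def E_def)
  qed (use K in \<open>simp add: B_def[symmetric] K_def[symmetric]\<close>)
qed

section \<open>Influences and the concentration of Fourier coefficients\<close>

text \<open>The polynomial \<open>p\<close> is the mean of the function when each coordinate of
  \<open>x\<close> is independently replaced by that of \<open>y\<close> with probability
  \<open>t\<close>. It is bounded by 1 on the unit interval, and its linear coefficient is the sum
  in question.\<close>

lemma norm_sum_differences_le:
  assumes c: "deg_le (Suc e) c" and bd: "\<And>x. x \<in> X \<Longrightarrow> norm (ev c x) \<le> 1"
    and x: "x \<in> X" and y: "\<And>j. j < N \<Longrightarrow> y j \<in> C"
  shows "norm (\<Sum>j<N. ev c (x(j := y j)) - ev c x) \<le> 2 * 5 ^ e"
proof -
  \<comment> \<open>Interpolates between the two powers and is constant when \<open>m i = 0\<close>,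
    so the product over \<open>i\<close> has degree at most \<open>card (supp m)\<close>.\<close>
  let ?lin = "\<lambda>m i. [:x i ^ m i, y i ^ m i - x i ^ m i:]"
  define p where "p = (\<Sum>m\<in>indices. smult (c m) (\<Prod>i<N. ?lin m i))"
  have "degree (smult (c m) (\<Prod>i<N. ?lin m i)) \<le> Suc e" if m: "m \<in> indices" for m
  proof (cases "c m = 0")
    case False
    have "degree (smult (c m) (\<Prod>i<N. ?lin m i)) \<le> degree (\<Prod>i<N. ?lin m i)"
      by (rule degree_smult_le)
    also have "\<dots> \<le> (\<Sum>i<N. degree (?lin m i))"
      by (rule order_trans[OF degree_prod_sum_le]) (auto simp: o_def)
    also have "\<dots> \<le> (\<Sum>i<N. if m i \<noteq> 0 then 1 else 0)"
      by (rule sum_mono) auto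
    also have "\<dots> = card (supp m)" by (simp add: supp_def sum.If_cases Int_def)
    also have "\<dots> \<le> Suc e" using c m False by (simp add: deg_le_def)
    finally show ?thesis .
  qed simp
  then have deg: "degree p \<le> Suc e" unfolding p_def by (intro degree_sum_le) auto
  have bound: "norm (poly p (of_real t)) \<le> 1" if t: "0 \<le> t" "t \<le> 1" for t
  proof -
    define xR where "xR R = (\<lambda>i\<in>{..<N}. if i \<in> R then x i else y i)" for R
    have xR: "xR R \<in> X" for R
      using X_D[OF x] y unfolding xR_def cyclic_cube_def by (intro restrict_PiE_iff[THEN iffD2]) auto
    \<comment> \<open>The probability that \<open>R\<close> is exactly the set of coordinates left
      unchanged.\<close>
    define wt where "wt R = (\<Prod>i\<in>R. 1 - t) * (\<Prod>i\<in>{..<N} - R. t)" for R :: "nat set"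
    have wt0: "wt R \<ge> 0" for R using t by (auto simp: wt_def intro!: mult_nonneg_nonneg)
    have "poly p (of_real t) = (\<Sum>m\<in>indices. c m *
        (\<Prod>i<N. of_real (1 - t) * x i ^ m i + of_real t * y i ^ m i))"
      by (simp add: p_def poly_sum poly_prod algebra_simps)
    also have "\<dots> = (\<Sum>m\<in>indices. c m * (\<Sum>R\<in>Pow {..<N}. of_real (wt R) * \<phi> m (xR R)))"
    proof (intro sum.cong refl arg_cong2[where f = "(*)"])
      fix m
      have "(\<Prod>i\<in>R. of_real (1 - t) * x i ^ m i) * (\<Prod>i\<in>{..<N} - R. of_real t * y i ^ m i) =
          of_real (wt R) * \<phi> m (xR R)" if R: "R \<in> Pow {..<N}" for R
      proof -
        have "\<phi> m (xR R) = (\<Prod>i\<in>R. xR R i ^ m i) * (\<Prod>i\<in>{..<N} - R. xR R i ^ m i)"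
          using R unfolding character_def
          by (subst prod.subset_diff[of R]) (auto simp: mult.commute)
        also have "(\<Prod>i\<in>R. xR R i ^ m i) = (\<Prod>i\<in>R. x i ^ m i)"
          using R by (intro prod.cong) (auto simp: xR_def)
        also have "(\<Prod>i\<in>{..<N} - R. xR R i ^ m i) = (\<Prod>i\<in>{..<N} - R. y i ^ m i)"
          by (intro prod.cong) (auto simp: xR_def)
        finally show ?thesis by (simp add: wt_def prod.distrib)
      qed
      then show "(\<Prod>i<N. of_real (1 - t) * x i ^ m i + of_real t * y i ^ m i) =
          (\<Sum>R\<in>Pow {..<N}. of_real (wt R) * \<phi> m (xR R))"
        by (subst prod_add) (auto intro!: sum.cong)
    qed
    also have "\<dots> = (\<Sum>R\<in>Pow {..<N}. of_real (wt R) * ev c (xR R))"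
      by (simp add: ev_def sum_distrib_left sum.swap[of _ indices] mult_ac)
    also have "norm \<dots> \<le> (\<Sum>R\<in>Pow {..<N}. wt R)"
    proof (rule sum_norm_le)
      fix R
      have "wt R * norm (ev c (xR R)) \<le> wt R * 1" by (intro mult_left_mono bd xR wt0)
      then show "norm (of_real (wt R) * ev c (xR R)) \<le> wt R"
        using wt0 by (simp add: norm_mult)
    qed
    also have "\<dots> = (\<Prod>i<N. (1 - t) + t)" unfolding wt_def by (subst prod_add) auto
    finally show ?thesis by simp
  qed
  have "coeff p 1 = (\<Sum>j<N. ev c (x(j := y j)) - ev c x)"
  proof -
    have ch: "\<phi> m (x(j := y j)) = (\<Prod>k<N. if k = j then y k ^ m k else x k ^ m k)" for m j
      unfolding character_def by (intro prod.cong) auto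
    have "coeff p 1 = (\<Sum>m\<in>indices. c m * coeff (\<Prod>i<N. ?lin m i) 1)"
      by (simp add: p_def coeff_sum)
    also have "\<dots> = (\<Sum>m\<in>indices. c m * (\<Sum>j<N. \<phi> m (x(j := y j)) - \<phi> m x))"
      unfolding ch by (subst coeff_1_prod_linear) (auto simp: character_def)
    also have "\<dots> = (\<Sum>j<N. ev c (x(j := y j)) - ev c x)"
      by (simp add: ev_def sum_distrib_left sum.swap[of _ indices] right_diff_distrib
          sum_subtractf[symmetric] del: fun_upd_apply)
    finally show ?thesis .
  qed
  then show ?thesis using norm_coeff_1_le[OF deg bound] by simp
qed

text \<open>Taking \<open>y\<close> equal to \<open>x\<close> outside \<open>J\<close> makes every
  subset sum an instance of the preceding bound, so absolute values cost only a factor 4.\<close>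

lemma sum_norm_differences_le:
  assumes c: "deg_le (Suc e) c" and bd: "\<And>x. x \<in> X \<Longrightarrow> norm (ev c x) \<le> 1"
    and x: "x \<in> X" and y: "\<And>j. j < N \<Longrightarrow> y j \<in> C"
  shows "(\<Sum>j<N. norm (ev c (x(j := y j)) - ev c x)) \<le> 8 * 5 ^ e"
proof -
  have "norm (\<Sum>j\<in>J. ev c (x(j := y j)) - ev c x) \<le> 2 * 5 ^ e" if J: "J \<subseteq> {..<N}" for J
  proof -
    define y' where "y' j = (if j \<in> J then y j else x j)" for j
    have "(\<Sum>j\<in>J. ev c (x(j := y j)) - ev c x) = (\<Sum>j<N. ev c (x(j := y' j)) - ev c x)"
      using J by (intro sum.mono_neutral_cong_left) (auto simp: y'_def)
    also have "norm \<dots> \<le> 2 * 5 ^ e"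
      by (rule norm_sum_differences_le[OF c bd x]) (use y X_D[OF x] in \<open>auto simp: y'_def\<close>)
    finally show ?thesis .
  qed
  from sum_norm_le_of_subset_sums[OF _ this] show ?thesis by simp
qed

text \<open>At each coordinate \<open>y j\<close> is chosen to maximise the increment. Parseval in
  that coordinate bounds the squares of the slices by the maximal increment, and Cauchy-Schwarz over
  the exponents costs \<open>sqrt q\<close>.\<close>

lemma sum_norm_slices_le:
  assumes c: "deg_le (Suc e) c" and bd: "\<And>x. x \<in> X \<Longrightarrow> norm (ev c x) \<le> 1"
    and x: "x \<in> X"
  shows "(\<Sum>j<N. \<Sum>s\<in>{1..<q}. norm (ev (slice j s c) x)) \<le> sqrt (real q) * (8 * 5 ^ e)"
proof -
  let ?D = "\<lambda>j y. norm (ev c (x(j := y)) - ev c x)"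
  have "\<exists>y\<in>C. \<forall>z\<in>C. ?D j z \<le> ?D j y" for j
  proof -
    have "C \<noteq> {}" using card_C q_pos by (metis card.empty less_irrefl)
    then have "Max (?D j ` C) \<in> ?D j ` C" by (intro Max_in) auto
    then obtain y where "y \<in> C" "Max (?D j ` C) = ?D j y" by blast
    then show ?thesis using Max_ge[of "?D j ` C"] by (intro bexI[of _ y]) auto
  qed
  then obtain y where y: "\<And>j. y j \<in> C" "\<And>j z. z \<in> C \<Longrightarrow> ?D j z \<le> ?D j (y j)" by metis
  have "(\<Sum>s\<in>{1..<q}. norm (ev (slice j s c) x)) \<le> sqrt (real q) * ?D j (y j)" if j: "j < N" for j
  proof -
    \<comment> \<open>Subtracting \<open>ev c x\<close> changes only the term of exponent 0.\<close>
    define b where "b s = (if s = 0 then ev (slice j 0 c) x - ev c x else ev (slice j s c) x)" for s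
    have split: "{..<q} = insert 0 {1..<q}" using q_pos by auto
    have b: "ev c (x(j := z)) - ev c x = (\<Sum>s<q. b s * z ^ s)" for z
      by (simp add: ev_upd[OF j] split b_def)
    have "real q * (\<Sum>s\<in>{1..<q}. (norm (b s))\<^sup>2) \<le> real q * (\<Sum>s<q. (norm (b s))\<^sup>2)"
      by (intro mult_left_mono sum_mono2) auto
    also have "\<dots> = (\<Sum>z\<in>C. (?D j z)\<^sup>2)"
      unfolding b by (rule parseval_roots_of_unity[OF q_pos, symmetric])
    also have "\<dots> \<le> (\<Sum>z\<in>C. (?D j (y j))\<^sup>2)" by (intro sum_mono power_mono y) auto
    also have "\<dots> = real q * (?D j (y j))\<^sup>2" by simp
    finally have l2: "(\<Sum>s\<in>{1..<q}. (norm (b s))\<^sup>2) \<le> (?D j (y j))\<^sup>2" using q_pos by simp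
    have "(\<Sum>s\<in>{1..<q}. norm (b s))\<^sup>2 \<le> (\<Sum>s\<in>{1..<q}. (norm (b s))\<^sup>2) * real (card {1..<q})"
      by (rule sum_squared_le_sum_of_squares)
    also have "\<dots> \<le> (?D j (y j))\<^sup>2 * real q" using l2 by (intro mult_mono) auto
    also have "\<dots> = (sqrt (real q) * ?D j (y j))\<^sup>2" by (simp add: power_mult_distrib)
    finally have "(\<Sum>s\<in>{1..<q}. norm (b s)) \<le> sqrt (real q) * ?D j (y j)"
      by (rule power2_le_imp_le) simp
    then show ?thesis by (simp add: b_def)
  qed
  then have "(\<Sum>j<N. \<Sum>s\<in>{1..<q}. norm (ev (slice j s c) x)) \<le> (\<Sum>j<N. sqrt (real q) * ?D j (y j))"
    by (intro sum_mono) auto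
  also have "\<dots> = sqrt (real q) * (\<Sum>j<N. ?D j (y j))" by (simp only: sum_distrib_left)
  also have "\<dots> \<le> sqrt (real q) * (8 * 5 ^ e)"
    using y by (intro mult_left_mono sum_norm_differences_le[OF c bd x]) auto
  finally show ?thesis .
qed

section \<open>Weights of pairs of a coordinate and an exponent\<close>

definition weight :: "((nat \<Rightarrow> nat) \<Rightarrow> complex) \<Rightarrow> nat \<Rightarrow> nat \<Rightarrow> real" where
  "weight c j s = sqrt (\<Sum>m\<in>{m \<in> indices. m j = s}. (norm (c m))\<^sup>2)"

lemma weight_square: "(weight c j s)\<^sup>2 = (\<Sum>m\<in>{m \<in> indices. m j = s}. (norm (c m))\<^sup>2)"
  by (simp add: weight_def sum_nonneg)

lemma weight_nonneg: "weight c j s \<ge> 0"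
  by (simp add: weight_def sum_nonneg)

lemma avg_slice_square:
  assumes "j < N" "s < q"
  shows "avg (\<lambda>x. (norm (ev (slice j s c) x))\<^sup>2) = (weight c j s)\<^sup>2"
proof -
  have "(\<Sum>m\<in>indices. (norm (slice j s c m))\<^sup>2) = (\<Sum>m\<in>{m\<in>indices. m j = 0}. (norm (c (m(j := s))))\<^sup>2)"
    by (rule sum.mono_neutral_cong_right) (auto simp: slice_def)
  also have "\<dots> = (\<Sum>m\<in>{m \<in> indices. m j = s}. (norm (c m))\<^sup>2)"
    by (rule sum.reindex_bij_witness[of _ "\<lambda>m. m(j := 0)" "\<lambda>m. m(j := s)"])
       (use assms q_pos in \<open>auto simp: indices_upd fun_upd_idem\<close>)
  finally show ?thesis by (simp add: parseval weight_square)
qed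

text \<open>The weights are second moments of slices, while the bound on the slices is pointwise and
  additive. Passing to first moments, at a cost governed by the degree \<open>e\<close> of a slice,
  allows that bound to be averaged.\<close>

lemma sum_weights_le:
  assumes c: "deg_le (Suc e) c" and bd: "\<And>x. x \<in> X \<Longrightarrow> norm (ev c x) \<le> 1"
  shows "(\<Sum>j<N. \<Sum>s\<in>{1..<q}. weight c j s) \<le> sqrt ((512 * real q) ^ Suc e)"
proof -
  define K where "K = sqrt (8 * (16 * real q) ^ e)"
  have "weight c j s \<le> K * avg (\<lambda>x. norm (ev (slice j s c) x))" if "j < N" "s \<in> {1..<q}" for j s
  proof (rule power2_le_imp_le)
    have "deg_le e (slice j s c)" using deg_le_slice[OF c, of j s] that by simp
    from norm_2_le_norm_1[OF this] that
    show "(weight c j s)\<^sup>2 \<le> (K * avg (\<lambda>x. norm (ev (slice j s c) x)))\<^sup>2"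
      by (simp add: avg_slice_square K_def power_mult_distrib)
  qed (auto simp: K_def intro!: mult_nonneg_nonneg avg_nonneg)
  then have "(\<Sum>j<N. \<Sum>s\<in>{1..<q}. weight c j s) \<le>
      (\<Sum>j<N. \<Sum>s\<in>{1..<q}. K * avg (\<lambda>x. norm (ev (slice j s c) x)))"
    by (intro sum_mono) auto
  also have "\<dots> = K * avg (\<lambda>x. \<Sum>j<N. \<Sum>s\<in>{1..<q}. norm (ev (slice j s c) x))"
    by (simp only: avg_sum sum_distrib_left)
  also have "\<dots> \<le> K * avg (\<lambda>x. sqrt (real q) * (8 * 5 ^ e))"
    using sum_norm_slices_le[OF c bd] by (intro mult_left_mono avg_mono) (auto simp: K_def)
  also have "\<dots> = K * (sqrt (real q) * (8 * 5 ^ e))" by simp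
  also have "\<dots> \<le> sqrt ((512 * real q) ^ Suc e)"
  proof (rule real_le_rsqrt)
    \<comment> \<open>Here \<open>512 = 8 * 8\<^sup>2\<close>, and below
      \<open>400 = 16 * 5\<^sup>2\<close>.\<close>
    have "(K * (sqrt (real q) * (8 * 5 ^ e)))\<^sup>2 = 512 * real q * ((16 * real q) ^ e * (5 ^ e)\<^sup>2)"
      by (simp add: K_def power_mult_distrib)
    also have "(16 * real q) ^ e * (5 ^ e)\<^sup>2 = (400 * real q) ^ e"
    proof -
      have "(5 ^ e)\<^sup>2 = (25::real) ^ e" by (simp add: power2_eq_square flip: power_mult_distrib)
      moreover have "16 * real q * 25 = 400 * real q" by simp
      ultimately show ?thesis by (simp only: power_mult_distrib[symmetric])
    qed
    also have "512 * real q * (400 * real q) ^ e \<le> 512 * real q * (512 * real q) ^ e"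
      by (intro mult_left_mono power_mono) auto
    finally show "(K * (sqrt (real q) * (8 * 5 ^ e)))\<^sup>2 \<le> (512 * real q) ^ Suc e" by simp
  qed
  finally show ?thesis .
qed

text \<open>A multi-index either contains a pair \<open>(j, s)\<close> of small weight, or is supported on the
  at most \<open>A / \<theta>\<close> pairs of large weight.\<close>

lemma sum_min_le:
  assumes c: "deg_le d c" and A: "(\<Sum>j<N. \<Sum>s\<in>{1..<q}. weight c j s) \<le> A" and l: "\<theta> > 0"
  shows "(\<Sum>m\<in>indices. min ((norm (c m))\<^sup>2) (\<eta>\<^sup>2)) \<le> \<theta> * A + \<eta>\<^sup>2 * (1 + A / \<theta>) ^ d"
proof -
  define U where "U = {..<N} \<times> {1..<q}"
  define P where "P = {(j, s) \<in> U. weight c j s > \<theta>}"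
  define Gd where "Gd = {m \<in> indices. card (supp m) \<le> d \<and> (\<lambda>j. (j, m j)) ` supp m \<subseteq> P}"
  have finU: "finite U" by (simp add: U_def)
  have PU: "P \<subseteq> U" by (auto simp: P_def)
  have finP: "finite P" using PU finU by (rule finite_subset)
  have AU: "(\<Sum>(j, s)\<in>U. weight c j s) \<le> A"
    using A by (simp add: U_def sum.cartesian_product)
  have "real (card P) * \<theta> = (\<Sum>(j, s)\<in>P. \<theta>)" by simp
  also have "\<dots> \<le> (\<Sum>(j, s)\<in>P. weight c j s)" by (intro sum_mono) (auto simp: P_def)
  also have "\<dots> \<le> (\<Sum>(j, s)\<in>U. weight c j s)"
    using finU PU by (intro sum_mono2) (auto simp: weight_nonneg)
  also note AU
  finally have cardP: "real (card P) \<le> A / \<theta>" using l by (simp add: field_simps)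
  have "card Gd \<le> card {S. S \<subseteq> P \<and> card S \<le> d}"
  proof (rule card_inj_on_le)
    \<comment> \<open>A multi-index is recovered from its graph over its support, because it is 0
      elsewhere.\<close>
    show "inj_on (\<lambda>m. (\<lambda>j. (j, m j)) ` supp m) Gd"
    proof (rule inj_onI)
      fix m n assume mn: "m \<in> Gd" "n \<in> Gd"
        and eq: "(\<lambda>j. (j, m j)) ` supp m = (\<lambda>j. (j, n j)) ` supp n"
      have *: "(j, s) \<in> (\<lambda>j. (j, m j)) ` supp m \<longleftrightarrow> j < N \<and> m j \<noteq> 0 \<and> s = m j" for m j s
        by (auto simp: supp_def)
      have "m j = n j" if "j < N" for j
        using *[of j "m j" m] *[of j "m j" n] *[of j "n j" m] *[of j "n j" n] eq that
        by (cases "m j = 0"; cases "n j = 0") auto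
      then show "m = n"
        using mn by (intro PiE_ext[of _ "{..<N}" "\<lambda>_. {0..<q}"]) (auto simp: Gd_def indices_def)
    qed
    show "(\<lambda>m. (\<lambda>j. (j, m j)) ` supp m) ` Gd \<subseteq> {S. S \<subseteq> P \<and> card S \<le> d}"
      by (auto simp: Gd_def intro: order_trans[OF card_image_le])
    show "finite {S. S \<subseteq> P \<and> card S \<le> d}" using finP by simp
  qed
  also have "\<dots> \<le> (card P + 1) ^ d" by (rule card_small_subsets_le[OF finP])
  finally have "real (card Gd) \<le> (real (card P) + 1) ^ d"
    by (metis of_nat_le_iff of_nat_power of_nat_add of_nat_1)
  also have "\<dots> \<le> (1 + A / \<theta>) ^ d" using cardP by (intro power_mono) auto
  finally have cardG: "real (card Gd) \<le> (1 + A / \<theta>) ^ d" .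
  \<comment> \<open>Indices in \<open>Gd\<close> are charged \<open>\<eta>\<^sup>2\<close>; any
    other index with nonzero coefficient is charged to a pair \<open>(j, m j)\<close> of small
    weight.\<close>
  have "min ((norm (c m))\<^sup>2) (\<eta>\<^sup>2) \<le> (if m \<in> Gd then \<eta>\<^sup>2 else 0) +
      (\<Sum>(j, s)\<in>U - P. if m j = s then (norm (c m))\<^sup>2 else 0)" if m: "m \<in> indices" for m
  proof -
    have nn: "(\<Sum>(j, s)\<in>U - P. if m j = s then (norm (c m))\<^sup>2 else 0) \<ge> 0"
      by (intro sum_nonneg) auto
    consider "m \<in> Gd" | "c m = 0" | j where "j \<in> supp m" "(j, m j) \<notin> P"
      using c m by (auto simp: Gd_def deg_le_def)
    then show ?thesis
    proof cases
      case 3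
      then have "(j, m j) \<in> U - P" using indices_D[OF m] by (auto simp: U_def supp_def)
      then have "(norm (c m))\<^sup>2 \<le> (\<Sum>(j, s)\<in>U - P. if m j = s then (norm (c m))\<^sup>2 else 0)"
        using member_le_sum[of "(j, m j)" "U - P" "\<lambda>(j, s). if m j = s then (norm (c m))\<^sup>2 else 0"]
          finU by auto
      then show ?thesis using nn by (auto simp: min_le_iff_disj)
    qed (use nn in \<open>auto simp: min_def\<close>)
  qed
  then have "(\<Sum>m\<in>indices. min ((norm (c m))\<^sup>2) (\<eta>\<^sup>2)) \<le> (\<Sum>m\<in>indices. (if m \<in> Gd then \<eta>\<^sup>2 else 0) +
      (\<Sum>(j, s)\<in>U - P. if m j = s then (norm (c m))\<^sup>2 else 0))"
    by (rule sum_mono)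
  also have "\<dots> = real (card Gd) * \<eta>\<^sup>2 + (\<Sum>(j, s)\<in>U - P. (weight c j s)\<^sup>2)"
  proof -
    have "(\<Sum>m\<in>indices. if m \<in> Gd then \<eta>\<^sup>2 else 0) = real (card Gd) * \<eta>\<^sup>2"
    proof -
      have "indices \<inter> {m. m \<in> Gd} = Gd" by (auto simp: Gd_def)
      then show ?thesis by (simp add: sum.If_cases)
    qed
    moreover have "(\<Sum>m\<in>indices. \<Sum>(j, s)\<in>U - P. if m j = s then (norm (c m))\<^sup>2 else 0) =
        (\<Sum>(j, s)\<in>U - P. (weight c j s)\<^sup>2)"
      by (subst sum.swap, intro sum.cong refl) (auto simp: weight_square sum.If_cases Int_def)
    ultimately show ?thesis by (simp add: sum.distrib)
  qed
  also have "(\<Sum>(j, s)\<in>U - P. (weight c j s)\<^sup>2) \<le> (\<Sum>(j, s)\<in>U - P. \<theta> * weight c j s)"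
    using weight_nonneg
    by (intro sum_mono) (auto simp: P_def power2_eq_square intro!: mult_right_mono)
  also have "\<dots> = \<theta> * (\<Sum>(j, s)\<in>U - P. weight c j s)"
    by (simp add: sum_distrib_left case_prod_unfold)
  also have "\<dots> \<le> \<theta> * A"
  proof (rule mult_left_mono)
    have "(\<Sum>(j, s)\<in>U - P. weight c j s) \<le> (\<Sum>(j, s)\<in>U. weight c j s)"
      using finU by (intro sum_mono2) (auto simp: weight_nonneg)
    then show "(\<Sum>(j, s)\<in>U - P. weight c j s) \<le> A" using AU by simp
  qed (use l in simp)
  also have "real (card Gd) * \<eta>\<^sup>2 \<le> (1 + A / \<theta>) ^ d * \<eta>\<^sup>2"
    using cardG by (rule mult_right_mono) simp
  finally show ?thesis by (simp add: mult_ac)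
qed

section \<open>Estimation of the coefficients\<close>

lemma multi_indices_eq: "multi_indices d q N = {m \<in> indices. card (supp m) \<le> d}"
  by (simp add: multi_indices_def indices_def supp_def)

text \<open>Keeps the logarithm in the sample bound away from 0, which absorbs the constant of the
  union bound.\<close>

lemma card_multi_indices_ge_2:
  assumes "d \<ge> 1" "N \<ge> 1"
  shows "card (multi_indices d q N) \<ge> 2"
proof -
  define z :: "nat \<Rightarrow> nat" where "z = (\<lambda>j\<in>{..<N}. 0)"
  have z: "z \<in> indices" using q_pos by (auto simp: z_def indices_def)
  have s: "supp z = {}" by (auto simp: supp_def z_def)
  have z0: "z 0 = 0" using assms by (simp add: z_def)
  have "{z, z(0 := 1)} \<subseteq> multi_indices d q N"
    using z s assms q_ge_2 indices_upd[OF z, of 0 1] by (auto simp: multi_indices_eq supp_upd)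
  then have "card {z, z(0 := 1)} \<le> card (multi_indices d q N)"
    by (rule card_mono[rotated]) (simp add: multi_indices_eq)
  moreover have "z \<noteq> z(0 := 1)" using z0 by (metis fun_upd_same zero_neq_one)
  ultimately show ?thesis by simp
qed

text \<open>Hoeffding's inequality for variables in \<open>[-1, 1]\<close>, whose squared ranges add
  up to \<open>4 * M\<close>.\<close>

lemma prob_sample_mean_deviation:
  fixes h :: "(nat \<Rightarrow> complex) \<Rightarrow> real"
  assumes h: "\<And>x. x \<in> X \<Longrightarrow> \<bar>h x\<bar> \<le> 1" and M: "M > 0" and t: "t \<ge> 0"
  shows "measure_pmf.prob (iid_uniform q N M) {\<omega>. \<bar>(\<Sum>j<M. h (\<omega> j)) / real M - avg h\<bar> \<ge> t}
    \<le> 2 * exp (- (real M * t\<^sup>2 / 2))"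
proof -
  define p where "p = iid_uniform q N M"
  have setp: "\<omega> i \<in> X" if "\<omega> \<in> set_pmf p" "i < M" for \<omega> i
    using that set_Pi_pmf_subset'[of "{..<M}" undefined "\<lambda>_. pmf_of_set X"] X_nonempty
    by (auto simp: p_def iid_uniform_def PiE_dflt_def)
  have indep: "prob_space.indep_vars (measure_pmf p) (\<lambda>_. borel) (\<lambda>i \<omega>. h (\<omega> i)) {..<M}"
    unfolding p_def iid_uniform_def
    by (rule prob_space.indep_vars_compose2[OF measure_pmf.prob_space_axioms indep_vars_Pi_pmf]) auto
  interpret Hoeffding_ineq "measure_pmf p" "{..<M}" "\<lambda>i \<omega>. h (\<omega> i)" "\<lambda>_. -1" "\<lambda>_. 1"
      "\<Sum>i<M. measure_pmf.expectation p (\<lambda>\<omega>. h (\<omega> i))"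
    by unfold_locales
       (use indep setp h in \<open>force simp: AE_measure_pmf_iff abs_le_iff\<close>)+
  have ex: "measure_pmf.expectation p (\<lambda>\<omega>. h (\<omega> i)) = avg h" if "i < M" for i
  proof -
    have "measure_pmf.expectation p (\<lambda>\<omega>. h (\<omega> i)) =
        measure_pmf.expectation (map_pmf (\<lambda>\<omega>. \<omega> i) p) h"
      by simp
    also have "map_pmf (\<lambda>\<omega>. \<omega> i) p = pmf_of_set X"
      unfolding p_def iid_uniform_def using that by (subst Pi_pmf_component) auto
    finally show ?thesis using X_nonempty by (simp add: integral_pmf_of_set avg_def card_X)
  qed
  have event: "{\<omega>. \<bar>(\<Sum>j<M. h (\<omega> j)) / real M - avg h\<bar> \<ge> t} =
      {\<omega> \<in> space (measure_pmf p). \<bar>(\<Sum>j<M. h (\<omega> j)) -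
        (\<Sum>i<M. measure_pmf.expectation p (\<lambda>\<omega>. h (\<omega> i)))\<bar> \<ge> real M * t}"
  proof -
    have "\<bar>S / real M - a\<bar> \<ge> t \<longleftrightarrow> \<bar>S - real M * a\<bar> \<ge> real M * t" for S a :: real
    proof -
      have "S - real M * a = real M * (S / real M - a)" using M by (simp add: field_simps)
      then show ?thesis using M by (simp add: abs_mult)
    qed
    then show ?thesis by (simp add: ex)
  qed
  have "measure_pmf.prob p {\<omega> \<in> space (measure_pmf p). \<bar>(\<Sum>j<M. h (\<omega> j)) -
        (\<Sum>i<M. measure_pmf.expectation p (\<lambda>\<omega>. h (\<omega> i)))\<bar> \<ge> real M * t}
      \<le> 2 * exp (-2 * (real M * t)\<^sup>2 / (\<Sum>i<M. (1 - (-1))\<^sup>2))"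
    using M t by (intro Hoeffding_ineq_abs_ge) auto
  moreover have "-2 * (real M * t)\<^sup>2 / (\<Sum>i<M. (1 - (-1))\<^sup>2) = - (real M * t\<^sup>2 / 2)"
    using M by (simp add: field_simps power2_eq_square)
  ultimately show ?thesis by (simp only: event p_def[symmetric])
qed

section \<open>The thresholding learner and its error\<close>

definition estimate :: "((nat \<Rightarrow> complex) \<times> complex) list \<Rightarrow> (nat \<Rightarrow> nat) \<Rightarrow> complex" where
  "estimate D m = (\<Sum>(x, v)\<leftarrow>D. v * cnj (\<phi> m x)) / of_nat (length D)"

lemma estimate_sample_data:
  "estimate (sample_data M f \<omega>) m = (\<Sum>j<M. f (\<omega> j) * cnj (\<phi> m (\<omega> j))) / of_nat M"
  by (simp add: estimate_def sample_data_def o_def interv_sum_list_conv_sum_set_nat lessThan_atLeast0)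

text \<open>By orthogonality the estimate has mean \<open>c m\<close>. A deviation of
  \<open>\<eta>\<close> forces one of \<open>\<eta> / 2\<close> in the real or the imaginary part,
  whence the constants 4 and 8.\<close>

lemma prob_estimate_deviation:
  assumes f: "\<And>x. x \<in> X \<Longrightarrow> f x = ev c x" and bd: "\<And>x. x \<in> X \<Longrightarrow> norm (f x) \<le> 1"
    and m: "m \<in> indices" and M: "M > 0" and t: "\<eta> \<ge> 0"
  shows "measure_pmf.prob (iid_uniform q N M) {\<omega>. norm (estimate (sample_data M f \<omega>) m - c m) \<ge> \<eta>}
    \<le> 4 * exp (- (real M * \<eta>\<^sup>2 / 8))"
proof -
  define Z where "Z x = f x * cnj (\<phi> m x)" for x
  have Z: "norm (Z x) \<le> 1" if "x \<in> X" for x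
    using that bd by (simp add: Z_def norm_mult norm_character)
  have sumZ: "(\<Sum>x\<in>X. Z x) = of_real (real q ^ N) * c m"
    using sum_ev_character[OF m, of c] by (simp add: Z_def f)
  have avgs: "avg (\<lambda>x. Re (Z x)) = Re (c m)" "avg (\<lambda>x. Im (Z x)) = Im (c m)"
    using q_pos by (simp_all only: avg_def Re_sum[symmetric] Im_sum[symmetric] sumZ Re_complex_of_real
        Im_complex_of_real times_complex.sel) simp_all
  let ?P = "measure_pmf.prob (iid_uniform q N M)"
  let ?bad = "\<lambda>g :: complex \<Rightarrow> real.
    {\<omega>. \<bar>(\<Sum>j<M. g (Z (\<omega> j))) / real M - avg (\<lambda>x. g (Z x))\<bar> \<ge> \<eta> / 2}"
  have sub: "{\<omega>. norm (estimate (sample_data M f \<omega>) m - c m) \<ge> \<eta>} \<subseteq> ?bad Re \<union> ?bad Im"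
  proof (rule subsetI)
    fix \<omega> assume "\<omega> \<in> {\<omega>. norm (estimate (sample_data M f \<omega>) m - c m) \<ge> \<eta>}"
    then have *: "\<eta> \<le> norm ((\<Sum>j<M. Z (\<omega> j)) / of_nat M - c m)"
      by (simp add: estimate_sample_data Z_def)
    also have "\<dots> \<le> \<bar>Re ((\<Sum>j<M. Z (\<omega> j)) / of_nat M - c m)\<bar>
        + \<bar>Im ((\<Sum>j<M. Z (\<omega> j)) / of_nat M - c m)\<bar>"
      by (rule cmod_le)
    finally show "\<omega> \<in> ?bad Re \<union> ?bad Im"
      by (auto simp: avgs)
  qed
  have b: "?P (?bad g) \<le> 2 * exp (- (real M * (\<eta> / 2)\<^sup>2 / 2))"
    if "\<And>z. \<bar>g z\<bar> \<le> norm z" for g :: "complex \<Rightarrow> real"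
    using order_trans[OF that Z] M t by (intro prob_sample_mean_deviation) auto
  have "?P {\<omega>. norm (estimate (sample_data M f \<omega>) m - c m) \<ge> \<eta>} \<le> ?P (?bad Re \<union> ?bad Im)"
    using sub by (intro measure_pmf.finite_measure_mono) auto
  also have "\<dots> \<le> ?P (?bad Re) + ?P (?bad Im)"
    by (intro measure_Un_le) auto
  also have "\<dots> \<le> 2 * exp (- (real M * (\<eta> / 2)\<^sup>2 / 2)) + 2 * exp (- (real M * (\<eta> / 2)\<^sup>2 / 2))"
    by (intro add_mono b abs_Re_le_cmod abs_Im_le_cmod)
  finally show ?thesis by (simp add: power_divide)
qed

text \<open>Thresholding prevents an error of order \<open>\<eta>\<^sup>2\<close> from every
  multi-index, whose number grows with \<open>N\<close>.\<close>

definition hypothesis :: "nat \<Rightarrow> real \<Rightarrow> learner" where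
  "hypothesis d \<eta> D x = (\<Sum>m\<in>multi_indices d q N.
     (if norm (estimate D m) \<ge> 2 * \<eta> then estimate D m else 0) * \<phi> m x)"

text \<open>A kept coefficient has modulus at least \<open>\<eta>\<close> and error at most
  \<open>\<eta>\<close>; a dropped one has modulus at most \<open>3 * \<eta>\<close>, which is its
  error. Parseval adds up the squares.\<close>

lemma L2_error_hypothesis:
  assumes f: "\<And>x. x \<in> X \<Longrightarrow> f x = ev c x" and c: "deg_le d c" and eta: "\<eta> \<ge> 0"
    and good: "\<And>m. m \<in> multi_indices d q N \<Longrightarrow> norm (estimate D m - c m) < \<eta>"
  shows "(L2_norm q N (\<lambda>x. hypothesis d \<eta> D x - f x))\<^sup>2 \<le>
    9 * (\<Sum>m\<in>indices. min ((norm (c m))\<^sup>2) (\<eta>\<^sup>2))"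
proof -
  define a where "a m = (if m \<in> multi_indices d q N \<and> norm (estimate D m) \<ge> 2 * \<eta>
    then estimate D m else 0)" for m
  have "hypothesis d \<eta> D x = ev a x" for x
    unfolding hypothesis_def ev_def
    by (rule sum.mono_neutral_cong_left) (auto simp: a_def multi_indices_eq)
  then have diff: "hypothesis d \<eta> D x - f x = ev (\<lambda>m. a m - c m) x" if "x \<in> X" for x
    using f[OF that] by (simp add: ev_def sum_subtractf left_diff_distrib)
  have "(L2_norm q N (\<lambda>x. hypothesis d \<eta> D x - f x))\<^sup>2 =
      avg (\<lambda>x. (norm (hypothesis d \<eta> D x - f x))\<^sup>2)"
    by (simp add: L2_norm_def avg_def sum_nonneg)
  also have "\<dots> = avg (\<lambda>x. (norm (ev (\<lambda>m. a m - c m) x))\<^sup>2)"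
    by (rule avg_cong) (simp add: diff)
  also have "\<dots> = (\<Sum>m\<in>indices. (norm (a m - c m))\<^sup>2)" by (rule parseval)
  also have "\<dots> \<le> (\<Sum>m\<in>indices. 9 * min ((norm (c m))\<^sup>2) (\<eta>\<^sup>2))"
  proof (rule sum_mono)
    fix m assume m: "m \<in> indices"
    have sq: "(norm (c m))\<^sup>2 \<le> 9 * \<eta>\<^sup>2" if "norm (c m) \<le> 3 * \<eta>"
      using power_mono[OF that, of 2] by (simp add: power_mult_distrib)
    show "(norm (a m - c m))\<^sup>2 \<le> 9 * min ((norm (c m))\<^sup>2) (\<eta>\<^sup>2)"
    proof (cases "m \<in> multi_indices d q N")
      case False
      then have "c m = 0" using c m by (auto simp: multi_indices_eq deg_le_def)
      then show ?thesis using False by (simp add: a_def)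
    next
      case True
      note g = good[OF True]
      show ?thesis
      proof (cases "norm (estimate D m) \<ge> 2 * \<eta>")
        case big: True
        have "norm (estimate D m) \<le> norm (estimate D m - c m) + norm (c m)"
          using norm_triangle_sub[of "estimate D m" "c m"] by simp
        then have "\<eta>\<^sup>2 \<le> (norm (c m))\<^sup>2" using g big eta by (intro power_mono) auto
        moreover have "(norm (estimate D m - c m))\<^sup>2 \<le> \<eta>\<^sup>2" using g by (intro power_mono) auto
        ultimately have "(norm (estimate D m - c m))\<^sup>2 \<le> 9 * min ((norm (c m))\<^sup>2) (\<eta>\<^sup>2)"
          using zero_le_power2[of \<eta>] unfolding min_def by (smt (verit))
        then show ?thesis using True big by (simp add: a_def)
      next
        case small: False
        have "norm (c m) \<le> norm (estimate D m - c m) + norm (estimate D m)"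
          using norm_triangle_sub[of "c m" "estimate D m"] by (simp add: norm_minus_commute)
        then have "norm (c m) \<le> 3 * \<eta>" using g small by simp
        from sq[OF this] show ?thesis using small by (simp add: a_def min_def)
      qed
    qed
  qed
  finally show ?thesis by (simp add: sum_distrib_left)
qed

lemma prob_hypothesis:
  assumes f: "\<And>x. x \<in> X \<Longrightarrow> f x = ev c x" and bd: "\<And>x. x \<in> X \<Longrightarrow> norm (f x) \<le> 1"
    and c: "deg_le d c" and eta: "\<eta> > 0" and M: "M > 0"
  shows "measure_pmf.prob (iid_uniform q N M)
      {\<omega>. (L2_norm q N (\<lambda>x. hypothesis d \<eta> (sample_data M f \<omega>) x - f x))\<^sup>2 \<le>
        9 * (\<Sum>m\<in>indices. min ((norm (c m))\<^sup>2) (\<eta>\<^sup>2))}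
    \<ge> 1 - 4 * real (card (multi_indices d q N)) * exp (- (real M * \<eta>\<^sup>2 / 8))"
proof -
  let ?P = "measure_pmf.prob (iid_uniform q N M)"
  define good where "good = {\<omega>. (L2_norm q N (\<lambda>x. hypothesis d \<eta> (sample_data M f \<omega>) x - f x))\<^sup>2 \<le>
        9 * (\<Sum>m\<in>indices. min ((norm (c m))\<^sup>2) (\<eta>\<^sup>2))}"
  let ?L = "multi_indices d q N"
  define bad where "bad m = {\<omega>. norm (estimate (sample_data M f \<omega>) m - c m) \<ge> \<eta>}" for m
  have fin: "finite ?L" by (simp add: multi_indices_eq)
  have "?P (UNIV - good) \<le> ?P (\<Union>m\<in>?L. bad m)"
  proof (rule measure_pmf.finite_measure_mono)
    show "UNIV - good \<subseteq> (\<Union>m\<in>?L. bad m)"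
    proof
      fix \<omega> assume w: "\<omega> \<in> UNIV - good"
      show "\<omega> \<in> (\<Union>m\<in>?L. bad m)"
      proof (rule ccontr)
        assume "\<omega> \<notin> (\<Union>m\<in>?L. bad m)"
        then have "norm (estimate (sample_data M f \<omega>) m - c m) < \<eta>" if "m \<in> ?L" for m
          using that by (auto simp: bad_def not_le)
        from L2_error_hypothesis[OF f c _ this] eta w show False by (simp add: good_def)
      qed
    qed
  qed simp
  also have "\<dots> \<le> (\<Sum>m\<in>?L. ?P (bad m))"
    using fin by (intro measure_pmf.finite_measure_subadditive_finite) auto
  also have "\<dots> \<le> (\<Sum>m\<in>?L. 4 * exp (- (real M * \<eta>\<^sup>2 / 8)))"
    unfolding bad_def using eta
    by (intro sum_mono prob_estimate_deviation[OF f bd _ M]) (auto simp: multi_indices_eq)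
  finally have "?P (UNIV - good) \<le> 4 * real (card ?L) * exp (- (real M * \<eta>\<^sup>2 / 8))" by simp
  moreover have "?P (UNIV - good) = 1 - ?P good"
    using measure_pmf.prob_compl[of good "iid_uniform q N M"] by simp
  ultimately show ?thesis by (simp add: good_def)
qed

section \<open>Choice of the accuracy and of the weight threshold\<close>

lemma low_degree_learning:
  assumes d: "d \<ge> 1" and N: "N \<ge> 1" and e: "0 < \<epsilon>" "\<epsilon> < 1" and dl: "0 < \<delta>" "\<delta> < 1"
    and M: "real M \<ge> 864 * (37 * (512 * real q) ^ d) ^ d / \<epsilon> ^ (d + 1)
      * ln (real (card (multi_indices d q N)) / \<delta>)"
  obtains alg :: learner where
    "\<And>f. f \<in> low_degree_functions d q N \<Longrightarrow> Linf_norm q N f \<le> 1 \<Longrightarrow>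
      measure_pmf.prob (iid_uniform q N M)
        {\<omega>. (L2_norm q N (\<lambda>x. alg (sample_data M f \<omega>) x - f x))\<^sup>2 < \<epsilon>} \<ge> 1 - \<delta>"
proof -
  define T where "T = (512 * real q) ^ d"
  define y where "y = real (card (multi_indices d q N)) / \<delta>"
  \<comment> \<open>Chosen so that the indices carrying only large weights contribute at most
    \<open>\<epsilon> / 36\<close> to the sum of minima; the others will contribute as much, and
    \<open>9 * (2 * \<epsilon> / 36) < \<epsilon>\<close>.\<close>
  define \<eta> where "\<eta> = sqrt (\<epsilon> ^ (d + 1) / (36 * (37 * T) ^ d))"
  have T1: "T \<ge> 1" unfolding T_def using q_pos by (intro one_le_power) auto
  have eta2: "\<eta>\<^sup>2 = \<epsilon> ^ (d + 1) / (36 * (37 * T) ^ d)"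
    unfolding \<eta>_def using e T1 by (intro real_sqrt_pow2) auto
  have eta: "\<eta> > 0" unfolding \<eta>_def using e T1 by simp
  have y2: "y \<ge> 2"
  proof -
    have "2 \<le> real (card (multi_indices d q N))" using card_multi_indices_ge_2[OF d N] by simp
    then have "2 * \<delta> \<le> real (card (multi_indices d q N))" using dl by linarith
    then show ?thesis using dl by (simp add: y_def le_divide_eq)
  qed
  then have lny: "ln y > 0" by simp
  have Meta: "real M * \<eta>\<^sup>2 \<ge> 24 * ln y"
  proof -
    \<comment> \<open>\<open>864 = 24 * 36\<close>. The 24 turns the exponent
      \<open>M * \<eta>\<^sup>2 / 8\<close> into at least \<open>3 * ln y\<close>, and
      \<open>4 * y * \<delta> / y ^ 3 \<le> \<delta>\<close> since \<open>y \<ge> 2\<close>.\<close>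
    have "864 * (37 * T) ^ d / \<epsilon> ^ (d + 1) * ln y * \<eta>\<^sup>2 = 24 * ln y"
      unfolding eta2 using e T1 by (simp add: field_simps)
    moreover have "864 * (37 * T) ^ d / \<epsilon> ^ (d + 1) * ln y * \<eta>\<^sup>2 \<le> real M * \<eta>\<^sup>2"
      using M unfolding T_def y_def by (rule mult_right_mono) simp
    ultimately show ?thesis by simp
  qed
  have M0: "M > 0" using Meta lny by (cases "M = 0") auto
  have fail: "4 * real (card (multi_indices d q N)) * exp (- (real M * \<eta>\<^sup>2 / 8)) \<le> \<delta>"
  proof -
    have "exp (- (real M * \<eta>\<^sup>2 / 8)) \<le> exp (- (3 * ln y))" using Meta by simp
    also have "\<dots> = 1 / y ^ 3"
      using y2 by (simp add: exp_minus exp_of_nat_mult[of 3, simplified] divide_inverse)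
    finally have "4 * real (card (multi_indices d q N)) * exp (- (real M * \<eta>\<^sup>2 / 8)) \<le>
        4 * (y * \<delta>) * (1 / y ^ 3)"
      using dl by (intro mult_mono) (auto simp: y_def)
    also have "\<dots> = \<delta> * (4 / y\<^sup>2)" using y2 by (simp add: power2_eq_square power3_eq_cube)
    also have "\<dots> \<le> \<delta> * 1"
      using power_mono[OF y2, of 2] y2 dl by (intro mult_left_mono) (auto simp: divide_le_eq_1)
    finally show ?thesis by simp
  qed
  show ?thesis
  \<comment> \<open>The learner is found by unification to be \<open>hypothesis d \<eta>\<close>; it
    is fixed before \<open>f\<close>, and \<open>\<eta>\<close> depends only on \<open>q\<close>,
    \<open>d\<close> and \<open>\<epsilon>\<close>.\<close>
  proof (rule that)
    fix f assume "f \<in> low_degree_functions d q N" and inf: "Linf_norm q N f \<le> 1"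
    then obtain c0 where c0: "\<And>x. x \<in> X \<Longrightarrow> f x = (\<Sum>m\<in>multi_indices d q N. c0 m * \<phi> m x)"
      by (auto simp: low_degree_functions_def)
    \<comment> \<open>The given coefficients are arbitrary beyond degree \<open>d\<close>; they are
      set to 0 there.\<close>
    define c where "c m = (if card (supp m) \<le> d then c0 m else 0)" for m
    have f: "f x = ev c x" if "x \<in> X" for x
      unfolding c0[OF that] ev_def
      by (rule sum.mono_neutral_cong_left) (auto simp: c_def multi_indices_eq)
    have c: "deg_le d c" by (simp add: deg_le_def c_def)
    have bd: "norm (f x) \<le> 1" if "x \<in> X" for x
    proof -
      have "norm (f x) \<le> Linf_norm q N f"
        unfolding Linf_norm_def using that by (intro Max_ge) auto
      then show ?thesis using inf by simp
    qed
    define A where "A = sqrt T"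
    have A: "A > 0" "A * A = T" using T1 by (auto simp: A_def)
    have W: "(\<Sum>j<N. \<Sum>s\<in>{1..<q}. weight c j s) \<le> A"
      using sum_weights_le[of "d - 1" c] d c bd f by (simp add: A_def T_def)
    \<comment> \<open>The weight threshold: \<open>l * A = \<epsilon> / 36\<close>, while
      \<open>A * A = T\<close> gives \<open>A / l = 36 * T / \<epsilon>\<close>.\<close>
    define l where "l = \<epsilon> / (36 * A)"
    have l: "l > 0" using e A by (simp add: l_def)
    have "(\<Sum>m\<in>indices. min ((norm (c m))\<^sup>2) (\<eta>\<^sup>2)) \<le> l * A + \<eta>\<^sup>2 * (1 + A / l) ^ d"
      by (rule sum_min_le[OF c W l])
    also have "l * A = \<epsilon> / 36" using A by (simp add: l_def)
    also have "A / l = 36 * T / \<epsilon>" using A e by (simp add: l_def field_simps)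
    also have "\<eta>\<^sup>2 * (1 + 36 * T / \<epsilon>) ^ d \<le> \<eta>\<^sup>2 * (37 * T / \<epsilon>) ^ d"
      using e T1 by (intro mult_left_mono power_mono) (auto simp: field_simps)
    also have "\<eta>\<^sup>2 * (37 * T / \<epsilon>) ^ d = \<epsilon> / 36"
      unfolding eta2 using e T1 by (simp add: power_divide)
    finally have "9 * (\<Sum>m\<in>indices. min ((norm (c m))\<^sup>2) (\<eta>\<^sup>2)) < \<epsilon>" using e by simp
    then have "measure_pmf.prob (iid_uniform q N M)
        {\<omega>. (L2_norm q N (\<lambda>x. hypothesis d \<eta> (sample_data M f \<omega>) x - f x))\<^sup>2 \<le>
          9 * (\<Sum>m\<in>indices. min ((norm (c m))\<^sup>2) (\<eta>\<^sup>2))}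
      \<le> measure_pmf.prob (iid_uniform q N M)
        {\<omega>. (L2_norm q N (\<lambda>x. hypothesis d \<eta> (sample_data M f \<omega>) x - f x))\<^sup>2 < \<epsilon>}"
      by (intro measure_pmf.finite_measure_mono) auto
    then show "1 - \<delta> \<le> measure_pmf.prob (iid_uniform q N M)
        {\<omega>. (L2_norm q N (\<lambda>x. hypothesis d \<eta> (sample_data M f \<omega>) x - f x))\<^sup>2 < \<epsilon>}"
      using prob_hypothesis[OF f bd c eta M0] fail by linarith
  qed
qed

end

section \<open>The constants of the sample bound\<close>

lemma sample_complexity_constant_le:
  fixes D :: real
  assumes D: "D\<^sup>2 \<ge> 37 * 512 * real q" and "q \<ge> 2" "d \<ge> 1"
  shows "(37 * (512 * real q) ^ d) ^ d \<le> D ^ (2 * d\<^sup>2)"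
proof -
  \<comment> \<open>Enlarging 37 to \<open>37 ^ d\<close> collects everything into one power with
    exponent \<open>d\<^sup>2\<close>, to be compared with powers of
    \<open>D\<^sup>2\<close>.\<close>
  have "(37 * (512 * real q) ^ d) ^ d \<le> (37 ^ d * (512 * real q) ^ d) ^ d"
    using assms by (intro power_mono mult_right_mono self_le_power) auto
  also have "\<dots> = (37 * 512 * real q) ^ d\<^sup>2"
    by (simp only: power_mult_distrib[symmetric] power_mult[symmetric] power2_eq_square mult.assoc)
  also have "\<dots> \<le> (D\<^sup>2) ^ d\<^sup>2" using D by (rule power_mono) simp
  finally show ?thesis by (simp add: power_mult)
qed

theorem theorem2p14:
  "\<exists>C0 > (0::real). \<exists>D1 :: nat \<Rightarrow> real.
     (\<forall>q\<ge>2. D1 q > 0) \<and>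
     (\<exists>A::real. \<forall>q\<ge>2. D1 q \<le> A * sqrt (real q) * ln (real q)) \<and>
     (\<forall>(q::nat) (d::nat) (N::nat) (\<epsilon>::real) (\<delta>::real) (M::nat).
        q \<ge> 2 \<longrightarrow> d \<ge> 1 \<longrightarrow> N \<ge> 1 \<longrightarrow>
        0 < \<epsilon> \<longrightarrow> \<epsilon> < 1 \<longrightarrow> 0 < \<delta> \<longrightarrow> \<delta> < 1 \<longrightarrow>
        real M \<ge> C0 * real d * D1 q ^ (2 * d\<^sup>2) * \<epsilon> powi (- (int d + 1))
                  * ln (real (card (multi_indices d q N)) / \<delta>) \<longrightarrow>
        (\<exists>alg :: learner. \<forall>f \<in> low_degree_functions d q N.
           Linf_norm q N f \<le> 1 \<longrightarrow>
           measure_pmf.prob (iid_uniform q N M)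
             {X. (L2_norm q N (\<lambda>x. alg (sample_data M f X) x - f x))\<^sup>2 < \<epsilon>} \<ge> 1 - \<delta>))"
proof -
  \<comment> \<open>As \<open>ln q \<ge> 2 / 3\<close>, the square is at least
    \<open>40000 * q\<close>, which exceeds \<open>37 * 512 * q = 18944 * q\<close>.\<close>
  define D1 where "D1 q = 300 * sqrt (real q) * ln (real q)" for q :: nat
  have pos: "D1 q > 0" if "q \<ge> 2" for q using that by (simp add: D1_def)
  have D1: "(D1 q)\<^sup>2 \<ge> 37 * 512 * real q" if "q \<ge> 2" for q
  proof -
    have "2 / 3 \<le> ln (real q)"
      using ln2_ge_two_thirds that by (intro order_trans[OF _ ln_mono[of 2 "real q"]]) auto
    then have "(2 / 3)\<^sup>2 \<le> (ln (real q))\<^sup>2" by (intro power_mono) auto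
    then have "90000 * real q * (2 / 3)\<^sup>2 \<le> 90000 * real q * (ln (real q))\<^sup>2"
      by (intro mult_left_mono) auto
    moreover have "(D1 q)\<^sup>2 = 90000 * real q * (ln (real q))\<^sup>2"
      by (simp add: D1_def power_mult_distrib)
    ultimately show ?thesis by (simp add: power2_eq_square)
  qed
  have main: "\<exists>alg :: learner. \<forall>f \<in> low_degree_functions d q N.
           Linf_norm q N f \<le> 1 \<longrightarrow>
           measure_pmf.prob (iid_uniform q N M)
             {X. (L2_norm q N (\<lambda>x. alg (sample_data M f X) x - f x))\<^sup>2 < \<epsilon>} \<ge> 1 - \<delta>"
    if a: "q \<ge> 2" "d \<ge> 1" "N \<ge> 1" "0 < \<epsilon>" "\<epsilon> < 1" "0 < \<delta>" "\<delta> < 1"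
      and M: "real M \<ge> 864 * real d * D1 q ^ (2 * d\<^sup>2) * \<epsilon> powi (- (int d + 1))
                  * ln (real (card (multi_indices d q N)) / \<delta>)"
    for q d N M :: nat and \<epsilon> \<delta> :: real
  proof -
    interpret fourier_cube q N using a(1) by unfold_locales
    let ?L = "ln (real (card (multi_indices d q N)) / \<delta>)"
    have "real (card (multi_indices d q N)) / \<delta> \<ge> 1"
      using card_multi_indices_ge_2[OF a(2,3)] a(6,7) by simp
    then have L: "?L \<ge> 0" by (rule ln_ge_zero)
    have eps: "\<epsilon> powi (- (int d + 1)) = 1 / \<epsilon> ^ (d + 1)"
      by (simp add: power_int_minus divide_inverse nat_add_distrib power_int_def power_inverse)
    have "(37 * (512 * real q) ^ d) ^ d \<le> real d * D1 q ^ (2 * d\<^sup>2)"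
    proof -
      have "1 * D1 q ^ (2 * d\<^sup>2) \<le> real d * D1 q ^ (2 * d\<^sup>2)"
        using a pos[OF a(1)] by (intro mult_right_mono) auto
      then show ?thesis using sample_complexity_constant_le[OF D1[OF a(1)] a(1,2)] by simp
    qed
    then have "864 * (37 * (512 * real q) ^ d) ^ d / \<epsilon> ^ (d + 1) * ?L \<le>
        864 * (real d * D1 q ^ (2 * d\<^sup>2)) / \<epsilon> ^ (d + 1) * ?L"
      using a L by (intro mult_right_mono divide_right_mono mult_left_mono) auto
    also have "\<dots> = 864 * real d * D1 q ^ (2 * d\<^sup>2) * \<epsilon> powi (- (int d + 1)) * ?L"
      unfolding eps by simp
    also note M
    finally obtain alg :: learner where
      "\<And>f. f \<in> low_degree_functions d q N \<Longrightarrow> Linf_norm q N f \<le> 1 \<Longrightarrow>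
        measure_pmf.prob (iid_uniform q N M)
          {\<omega>. (L2_norm q N (\<lambda>x. alg (sample_data M f \<omega>) x - f x))\<^sup>2 < \<epsilon>} \<ge> 1 - \<delta>"
      using low_degree_learning[OF a(2-7)] by blast
    then show ?thesis by blast
  qed
  show ?thesis
  proof (rule exI[of _ 864], intro conjI exI[of _ D1])
    show "\<exists>A. \<forall>q\<ge>2. D1 q \<le> A * sqrt (real q) * ln (real q)"
      by (rule exI[of _ 300]) (simp add: D1_def)
  qed (use pos main in \<open>simp_all add: Ball_def\<close>)
qed

end
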